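(* Let $d\ge1$ and $1\le i\le d$. Let $\varphi:\mathbb R^d\to[0,1]$ be a radial, non-negative, smooth function, not identically zero, with $\mathrm{supp}\,\varphi\subset\{\xi\in\mathbb R^d:\ 4/3\le|\xi|\le3/2\}$, and let $\check\varphi$ be its inverse Fourier transform. Let either $\chi=\partial_i\check\varphi$ (with $d\ge1$) or $\chi=x_i\check\varphi$ (with $d\ge2$), and for integers $n\ge3$ define $$f_n(x)=\Gamma_n\sum_{k=1}^{n}\frac1k\,\chi(2^kx),\qquad \Gamma_n=\frac{1}{\ln\ln n}.$$ Then $$\|f_n\|_{L^\infty(\mathbb R^d)}\le C\,\Gamma_n\qquad\text{and}\qquad \|\mathcal R_if_n\|_{L^\infty(\mathbb R^d)}\approx\Gamma_n\ln n,$$ where $\mathcal R_i$ is the $i$-th component of the classical Riesz transform, and $C>0$ and the implicit constants in $\approx$ are independent of $n$.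
   Context: $A\approx B$ means $C^{-1}B\le A\le CB$ for a positive constant $C$ independent of $n$. Conventions: $\hat u(\xi)=(2\pi)^{-d/2}\int e^{-\mathrm i x\cdot\xi}u(x)\,dx$, $\check u(x)=(2\pi)^{-d/2}\int e^{\mathrm i x\cdot\xi}u(\xi)\,d\xi$. The Riesz transform $\mathcal R_i$ is the Fourier multiplier with symbol $-\mathrm i\xi_i/|\xi|$. *)

theory Defs
  imports "HOL-Probability.Essential_Supremum"
begin

(* Bochner integrals are 0 on non-integrable functions, so the two transforms below are
   meaningful for functions in L1 only. *)
definition fourier :: "(real ^ 'd \<Rightarrow> complex) \<Rightarrow> real ^ 'd \<Rightarrow> complex" where
  "fourier u \<xi> = complex_of_real ((2 * pi) powr (- real CARD('d) / 2)) *
     (LINT x|lebesgue. exp (- \<i> * complex_of_real (x \<bullet> \<xi>)) * u x)"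

definition inv_fourier :: "(real ^ 'd \<Rightarrow> complex) \<Rightarrow> real ^ 'd \<Rightarrow> complex" where
  "inv_fourier u x = complex_of_real ((2 * pi) powr (- real CARD('d) / 2)) *
     (LINT \<xi>|lebesgue. exp (\<i> * complex_of_real (x \<bullet> \<xi>)) * u \<xi>)"

(* Pointwise formula, for u such that u and (m times the transform of u) are integrable;
   this covers Schwartz functions u and bounded measurable symbols m. *)
definition fourier_multiplier ::
    "(real ^ 'd \<Rightarrow> complex) \<Rightarrow> (real ^ 'd \<Rightarrow> complex) \<Rightarrow> real ^ 'd \<Rightarrow> complex" where
  "fourier_multiplier m u = inv_fourier (\<lambda>\<xi>. m \<xi> * fourier u \<xi>)"

(* The symbol takes the value 0 at the origin, since x / 0 = 0. *)
definition riesz :: "'d \<Rightarrow> (real ^ 'd \<Rightarrow> complex) \<Rightarrow> real ^ 'd \<Rightarrow> complex" where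
  "riesz i = fourier_multiplier (\<lambda>\<xi>. - \<i> * complex_of_real (\<xi> $ i / norm \<xi>))"

definition Linf_norm :: "(real ^ 'd \<Rightarrow> complex) \<Rightarrow> ennreal" where
  "Linf_norm u = esssup lebesgue (\<lambda>x. ennreal (norm (u x)))"

definition partial_deriv :: "'d \<Rightarrow> (real ^ 'd \<Rightarrow> complex) \<Rightarrow> real ^ 'd \<Rightarrow> complex" where
  "partial_deriv i u x = vector_derivative (\<lambda>t. u (x + t *\<^sub>R axis i 1)) (at 0)"

definition radial :: "(real ^ 'd \<Rightarrow> real) \<Rightarrow> bool" where
  "radial u \<longleftrightarrow> (\<forall>x y. norm x = norm y \<longrightarrow> u x = u y)"

(* Ck k u: u has continuous iterated directional derivatives of all orders up to k and is
   Frechet differentiable at each stage. *)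
primrec Ck :: "nat \<Rightarrow> (real ^ 'd \<Rightarrow> real) \<Rightarrow> bool" where
  "Ck 0 u \<longleftrightarrow> continuous_on UNIV u"
| "Ck (Suc k) u \<longleftrightarrow> (\<forall>x. u differentiable (at x)) \<and>
     (\<forall>v. Ck k (\<lambda>x. frechet_derivative u (at x) v))"

definition smooth :: "(real ^ 'd \<Rightarrow> real) \<Rightarrow> bool" where
  "smooth u \<longleftrightarrow> (\<forall>k. Ck k u)"

definition Gam :: "nat \<Rightarrow> real" where
  "Gam n = 1 / ln (ln (real n))"

definition f_seq :: "(real ^ 'd \<Rightarrow> complex) \<Rightarrow> nat \<Rightarrow> real ^ 'd \<Rightarrow> complex" where
  "f_seq chi n x = complex_of_real (Gam n) *
     (\<Sum>k = 1..n. complex_of_real (1 / real k) * chi ((2 ^ k) *\<^sub>R x))"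

end

theory Submission
  imports Defs "HOL-Probability.Characteristic_Functions" "HOL-Probability.Sinc_Integral"
begin

text \<open>
  Both choices of \<open>chi\<close> are \<open>\<i>\<close> times the inverse Fourier transform of a real test function \<open>u\<close>:
  \<open>u \<xi> = \<xi> $ i * \<phi> \<xi>\<close> for the derivative, and the \<open>i\<close>-th partial derivative of \<open>\<phi>\<close> for the product
  with \<open>x $ i\<close>. In both cases \<open>chi\<close> vanishes at the origin (for the derivative because \<open>u\<close> is odd),
  is Lipschitz, and decays at infinity. So the \<open>k\<close>-th term of the sum is at most a multiple of
  \<open>min a (1 / a)\<close> with \<open>a = 2 ^ k * norm x\<close>. These bounds are summable over the dyadic scales uniformly in
  \<open>x\<close>: they decay geometrically as \<open>2 ^ k\<close> moves away from \<open>1 / norm x\<close>. Hence \<open>f_seq chi n\<close> is bounded by a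
  multiple of \<open>Gam n\<close> (lemmas \<open>dyadic_sum_le\<close> and \<open>f_seq_le_Gam\<close>).

  The Riesz symbol is homogeneous of degree 0, so the Riesz transform commutes with the dilations and
  maps the sum for \<open>chi\<close> to the sum for \<open>V\<close>, the inverse transform of \<open>\<xi> $ i / norm \<xi> * u \<xi>\<close> (lemma
  \<open>riesz_f_seq\<close>). The cancellation at the origin is now lost: up to a positive factor, \<open>V 0\<close> is the
  integral of \<open>\<xi> $ i / norm \<xi> * u \<xi>\<close>. For the first choice the integrand is
  \<open>(\<xi> $ i)\<^sup>2 / norm \<xi> * \<phi> \<xi>\<close>, for the second choice an integration by parts turns it into
  \<open>- ((norm \<xi>)\<^sup>2 - (\<xi> $ i)\<^sup>2) / norm \<xi> ^ 3 * \<phi> \<xi>\<close>, and this does not vanish identically as soon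
  as there are two coordinates. Hence at \<open>x = 0\<close> all terms add up to \<open>Gam n * harm n * V 0\<close>, of size
  \<open>Gam n * ln n\<close>; since \<open>V\<close> is continuous and bounded, this is the order of the essential supremum
  (lemma \<open>f_seq_log_growth\<close>).

  To compute the Fourier transform of \<open>chi\<close> one needs its integrability and the inversion formula.
  Integrability follows from decay of every polynomial order, each order costing one integration by
  parts (lemma \<open>wave_integral_frechet_derivative\<close>); inversion is proved by Gaussian regularisation
  (lemma \<open>wave_integral_inversion\<close>).
\<close>

section \<open>The unnormalised inverse Fourier integral\<close>

text \<open>Both transforms are multiples of this integral, the forward one after a reflection of the argument.
  The measure \<open>lborel\<close> replaces \<open>lebesgue\<close> because Gaussian integrals and Fubini's theorem use its
  product structure; for Borel functions the two integrals agree.\<close>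

definition wave_integral :: "(real ^ 'd \<Rightarrow> complex) \<Rightarrow> real ^ 'd \<Rightarrow> complex" where
  "wave_integral u x = (LINT \<xi>|lborel. cis (x \<bullet> \<xi>) * u \<xi>)"

definition fourier_const :: "'d::finite itself \<Rightarrow> real" where
  "fourier_const _ = (2 * pi) powr (- real CARD('d) / 2)"

lemma fourier_const_pos: "fourier_const TYPE('d::finite) > 0"
  by (simp add: fourier_const_def)

lemma fourier_const_square: "fourier_const TYPE('d::finite) ^ 2 * (2 * pi) ^ CARD('d) = 1"
proof -
  have "fourier_const TYPE('d) ^ 2 = (2 * pi) powr (- real CARD('d))"
    by (simp add: fourier_const_def power2_eq_square powr_add[symmetric])
  moreover have "(2 * pi) ^ CARD('d) = (2 * pi) powr real CARD('d)"
    by (simp add: powr_realpow)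
  ultimately show ?thesis
    by (simp only: powr_add[symmetric]) simp
qed

lemma continuous_on_cis_compose [continuous_intros]:
  "continuous_on A f \<Longrightarrow> continuous_on A (\<lambda>x. cis (f x))"
  by (simp add: cis_conv_exp) (intro continuous_intros)

lemma cis_inner_borel [measurable]: "(\<lambda>\<xi>. cis (x \<bullet> \<xi>)) \<in> borel_measurable borel"
  by (intro borel_measurable_continuous_onI continuous_intros)

lemma inv_fourier_eq_wave_integral:
  fixes u :: "real ^ 'd \<Rightarrow> complex"
  assumes [measurable]: "u \<in> borel_measurable borel"
  shows "inv_fourier u x = complex_of_real (fourier_const TYPE('d)) * wave_integral u x"
  unfolding inv_fourier_def wave_integral_def fourier_const_def
  by (simp add: integral_completion cis_conv_exp[symmetric])

lemma fourier_eq_wave_integral: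
  fixes u :: "real ^ 'd \<Rightarrow> complex"
  assumes [measurable]: "u \<in> borel_measurable borel"
  shows "fourier u \<xi> = complex_of_real (fourier_const TYPE('d)) * wave_integral u (- \<xi>)"
proof -
  have "exp (- \<i> * complex_of_real (x \<bullet> \<xi>)) = cis (- \<xi> \<bullet> x)" for x
    by (simp add: cis_conv_exp inner_commute)
  then show ?thesis
    unfolding fourier_def wave_integral_def fourier_const_def
    by (simp add: integral_completion del: inner_minus_left)
qed

section \<open>Affine changes of variables\<close>

lemma lborel_integral_affine:
  fixes f :: "'a::euclidean_space \<Rightarrow> 'b::{banach, second_countable_topology}"
  assumes [measurable]: "f \<in> borel_measurable borel" and "c \<noteq> 0"
  shows "(LINT x|lborel. f x) = \<bar>c\<bar> ^ DIM('a) *\<^sub>R (LINT x|lborel. f (t + c *\<^sub>R x))"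
  by (subst lborel_affine[OF \<open>c \<noteq> 0\<close>, of t])
     (simp add: integral_density integral_distr)

lemma lborel_integral_translate:
  fixes f :: "'a::euclidean_space \<Rightarrow> 'b::{banach, second_countable_topology}"
  assumes [measurable]: "f \<in> borel_measurable borel"
  shows "(LINT x|lborel. f (t + x)) = (LINT x|lborel. f x)"
  using lborel_integral_affine[OF assms, of 1 t] by simp

lemma lborel_integrable_affine:
  fixes f :: "'a::euclidean_space \<Rightarrow> 'b::{banach, second_countable_topology}"
  assumes f: "integrable lborel f" and "c \<noteq> 0"
  shows "integrable lborel (\<lambda>x. f (t + c *\<^sub>R x))"
proof -
  have [measurable]: "f \<in> borel_measurable borel" using f by auto
  have "integrable (density (distr lborel borel (\<lambda>x. t + c *\<^sub>R x)) (\<lambda>_. ennreal (\<bar>c\<bar> ^ DIM('a)))) f"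
    using f \<open>c \<noteq> 0\<close> by (subst (asm) lborel_affine[of c t]) simp_all
  then have "integrable lborel (\<lambda>x. \<bar>c\<bar> ^ DIM('a) *\<^sub>R f (t + c *\<^sub>R x))"
    by (simp add: integrable_density integrable_distr_eq)
  then have "integrable lborel (\<lambda>x. inverse (\<bar>c\<bar> ^ DIM('a)) *\<^sub>R (\<bar>c\<bar> ^ DIM('a) *\<^sub>R f (t + c *\<^sub>R x)))"
    by (rule integrable_scaleR_right)
  moreover have "(\<lambda>x. inverse (\<bar>c\<bar> ^ DIM('a)) *\<^sub>R (\<bar>c\<bar> ^ DIM('a) *\<^sub>R f (t + c *\<^sub>R x))) = (\<lambda>x. f (t + c *\<^sub>R x))"
    using \<open>c \<noteq> 0\<close> by (simp add: fun_eq_iff)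
  ultimately show ?thesis by (simp only:)
qed

lemma wave_integral_scaled:
  fixes u :: "real ^ 'd \<Rightarrow> complex"
  assumes [measurable]: "u \<in> borel_measurable borel" and "c \<noteq> 0"
  shows "wave_integral (\<lambda>\<xi>. u (c *\<^sub>R \<xi>)) x
    = complex_of_real (\<bar>1 / c\<bar> ^ CARD('d)) * wave_integral u ((1 / c) *\<^sub>R x)"
proof -
  have "wave_integral (\<lambda>\<xi>. u (c *\<^sub>R \<xi>)) x =
     \<bar>1 / c\<bar> ^ CARD('d) *\<^sub>R
       (LINT \<xi>|lborel. cis (x \<bullet> (0 + (1 / c) *\<^sub>R \<xi>)) * u (c *\<^sub>R (0 + (1 / c) *\<^sub>R \<xi>)))"
    unfolding wave_integral_def using assms
    by (subst lborel_integral_affine[where c = "1 / c" and t = 0]) auto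
  then show ?thesis
    using \<open>c \<noteq> 0\<close> by (simp add: wave_integral_def scaleR_conv_of_real[where 'a = complex])
qed

section \<open>Bounded functions with bounded support\<close>

text \<open>A class of integrable functions that contains the test functions and is preserved by
  multiplication with the Riesz symbol, which is discontinuous at the origin.\<close>

definition cutoff :: "(real ^ 'd \<Rightarrow> 'b::real_normed_vector) \<Rightarrow> bool" where
  "cutoff u \<longleftrightarrow> u \<in> borel_measurable borel \<and> (\<exists>B. \<forall>\<xi>. norm (u \<xi>) \<le> B) \<and>
     (\<exists>R. \<forall>\<xi>. R < norm \<xi> \<longrightarrow> u \<xi> = 0)"

lemma cutoff_measurable [measurable_dest]: "cutoff u \<Longrightarrow> u \<in> borel_measurable borel"
  by (simp add: cutoff_def)

lemma cutoff_integrable: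
  fixes u :: "real ^ 'd \<Rightarrow> 'b::{banach, second_countable_topology}"
  assumes "cutoff u"
  shows "integrable lborel u"
proof -
  obtain B R where "\<And>\<xi>. norm (u \<xi>) \<le> B" and R: "\<And>\<xi>. R < norm \<xi> \<Longrightarrow> u \<xi> = 0"
    using assms by (auto simp: cutoff_def)
  moreover have "emeasure lborel (cball 0 R :: (real ^ 'd) set) < \<infinity>"
    by (rule emeasure_bounded_finite) simp
  ultimately show ?thesis
    using assms
    by (intro integrableI_bounded_set[of "cball 0 R" _ _ B]) (auto simp: cutoff_def not_le)
qed

lemma cutoff_mult_locally_bounded:
  fixes u :: "real ^ 'd \<Rightarrow> 'b::real_normed_algebra"
  assumes u: "cutoff u"
    and m: "\<And>R. \<exists>B. \<forall>\<xi>. norm \<xi> \<le> R \<longrightarrow> norm (m \<xi>) \<le> B"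
    and meas: "(\<lambda>\<xi>. m \<xi> * u \<xi>) \<in> borel_measurable borel"
  shows "cutoff (\<lambda>\<xi>. m \<xi> * u \<xi>)"
proof -
  obtain B R where B: "\<And>\<xi>. norm (u \<xi>) \<le> B" and R: "\<And>\<xi>. R < norm \<xi> \<Longrightarrow> u \<xi> = 0"
    using u by (auto simp: cutoff_def)
  obtain B' where B': "\<And>\<xi>. norm \<xi> \<le> R \<Longrightarrow> norm (m \<xi>) \<le> B'"
    using m[of R] by auto
  have "norm (m \<xi> * u \<xi>) \<le> \<bar>B'\<bar> * \<bar>B\<bar>" for \<xi>
  proof (cases "norm \<xi> \<le> R")
    case True
    have "norm (m \<xi> * u \<xi>) \<le> norm (m \<xi>) * norm (u \<xi>)"
      by (rule norm_mult_ineq)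
    also have "\<dots> \<le> \<bar>B'\<bar> * \<bar>B\<bar>"
      using B'[OF True] B[of \<xi>] by (intro mult_mono) auto
    finally show ?thesis .
  qed (simp add: R)
  then show ?thesis
    using R meas unfolding cutoff_def by (metis mult_zero_right)
qed

lemma cutoff_continuous_mult:
  fixes u :: "real ^ 'd \<Rightarrow> 'b::{real_normed_algebra, second_countable_topology}"
  assumes u: "cutoff u" and m: "continuous_on UNIV m"
  shows "cutoff (\<lambda>\<xi>. m \<xi> * u \<xi>)"
proof (rule cutoff_mult_locally_bounded[OF u])
  have "m \<in> borel_measurable borel"
    using m by (rule borel_measurable_continuous_onI)
  then show "(\<lambda>\<xi>. m \<xi> * u \<xi>) \<in> borel_measurable borel"
    using u by measurable
  show "\<exists>B. \<forall>\<xi>. norm \<xi> \<le> R \<longrightarrow> norm (m \<xi>) \<le> B" for R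
  proof -
    have "compact (m ` cball 0 R)"
      by (intro compact_continuous_image continuous_on_subset[OF m] compact_cball) auto
    then have "bounded (m ` cball 0 R)" by (rule compact_imp_bounded)
    then show ?thesis unfolding bounded_iff by fastforce
  qed
qed

lemma cutoff_of_real: "cutoff u \<Longrightarrow> cutoff (\<lambda>\<xi>. complex_of_real (u \<xi>))"
  unfolding cutoff_def by auto

lemma wave_integrand_integrable:
  assumes "integrable lborel u"
  shows "integrable lborel (\<lambda>\<xi>. cis (x \<bullet> \<xi>) * u \<xi>)"
  using assms by (rule Bochner_Integration.integrable_bound) (use assms in \<open>auto simp: norm_mult\<close>)

lemma wave_integral_norm_le:
  "norm (wave_integral u x) \<le> (LINT \<xi>|lborel. norm (u \<xi>))"
proof -
  have "norm (wave_integral u x) \<le> (LINT \<xi>|lborel. norm (cis (x \<bullet> \<xi>) * u \<xi>))"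
    unfolding wave_integral_def by (rule integral_norm_bound)
  then show ?thesis by (simp add: norm_mult)
qed

lemma norm_cis_diff_le: "norm (cis a - cis b) \<le> \<bar>a - b\<bar>"
proof -
  have "cis a - cis b = cis b * (cis (a - b) - 1)"
    by (simp add: cis_mult algebra_simps)
  then have "norm (cis a - cis b) = norm (cis (a - b) - 1)"
    by (simp add: norm_mult)
  then show ?thesis
    using iexp_approx1[of "a - b" 0] by (simp add: cis_conv_exp)
qed

lemma norm_cis_taylor: "norm (cis t - 1 - \<i> * t) \<le> t\<^sup>2 / 2"
  using iexp_approx1[of t 1] by (simp add: cis_conv_exp numeral_2_eq_2 diff_diff_eq)

text \<open>The phase \<open>cis (x \<bullet> \<xi>)\<close> is Lipschitz in \<open>x\<close> with constant \<open>norm \<xi>\<close>, and \<open>norm \<xi> * norm (u \<xi>)\<close> is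
  integrable.\<close>

lemma wave_integral_lipschitz:
  assumes "cutoff u"
  shows "\<exists>L>0. \<forall>x y. norm (wave_integral u x - wave_integral u y) \<le> L * norm (x - y)"
proof (intro exI conjI allI)
  let ?L = "LINT \<xi>|lborel. norm \<xi> * norm (u \<xi>)"
  have "cutoff (\<lambda>\<xi>. norm \<xi> * norm (u \<xi>))"
    using assms by (intro cutoff_continuous_mult) (auto simp: cutoff_def intro!: continuous_intros)
  then have int: "integrable lborel (\<lambda>\<xi>. norm \<xi> * norm (u \<xi>))" by (rule cutoff_integrable)
  have "?L \<ge> 0" by (rule Bochner_Integration.integral_nonneg) simp
  then show "?L + 1 > 0" by linarith
  fix x y :: "real ^ 'a"
  have iu: "integrable lborel u" using assms by (rule cutoff_integrable)
  have [measurable]: "u \<in> borel_measurable borel" using assms by measurable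
  have "wave_integral u x - wave_integral u y = (LINT \<xi>|lborel. (cis (x \<bullet> \<xi>) - cis (y \<bullet> \<xi>)) * u \<xi>)"
    unfolding wave_integral_def
    by (simp add: left_diff_distrib Bochner_Integration.integral_diff wave_integrand_integrable[OF iu])
  also have "norm \<dots> \<le> (LINT \<xi>|lborel. norm (x - y) * (norm \<xi> * norm (u \<xi>)))"
  proof (rule Bochner_Integration.integral_norm_bound_integral)
    show "integrable lborel (\<lambda>\<xi>. (cis (x \<bullet> \<xi>) - cis (y \<bullet> \<xi>)) * u \<xi>)"
      by (simp add: left_diff_distrib wave_integrand_integrable[OF iu])
    show "integrable lborel (\<lambda>\<xi>. norm (x - y) * (norm \<xi> * norm (u \<xi>)))"
      using int by simp
    fix \<xi> :: "real ^ 'a"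
    have "norm (cis (x \<bullet> \<xi>) - cis (y \<bullet> \<xi>)) \<le> \<bar>(x - y) \<bullet> \<xi>\<bar>"
      using norm_cis_diff_le[of "x \<bullet> \<xi>" "y \<bullet> \<xi>"] by (simp add: inner_diff_left)
    also have "\<dots> \<le> norm (x - y) * norm \<xi>" by (rule Cauchy_Schwarz_ineq2)
    finally show "norm ((cis (x \<bullet> \<xi>) - cis (y \<bullet> \<xi>)) * u \<xi>) \<le> norm (x - y) * (norm \<xi> * norm (u \<xi>))"
      by (simp only: norm_mult mult.assoc[symmetric]) (rule mult_right_mono, auto)
  qed
  also have "\<dots> = norm (x - y) * ?L" by simp
  also have "\<dots> \<le> (?L + 1) * norm (x - y)" by (simp add: algebra_simps)
  finally show "norm (wave_integral u x - wave_integral u y) \<le> (?L + 1) * norm (x - y)" .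
qed

lemma wave_integral_continuous:
  assumes "cutoff u"
  shows "continuous_on UNIV (wave_integral u)"
proof -
  obtain L where "L > 0"
    and "\<And>x y. norm (wave_integral u x - wave_integral u y) \<le> L * norm (x - y)"
    using wave_integral_lipschitz[OF assms] by blast
  then have "L-lipschitz_on UNIV (wave_integral u)"
    by (intro lipschitz_onI) (auto simp: dist_norm)
  then show ?thesis by (rule lipschitz_on_continuous_on)
qed

text \<open>Differentiation under the integral: the Taylor remainder of the phase is at most
  \<open>(t * \<xi> $ j)\<^sup>2 / 2\<close>, which gives an error of order \<open>t\<^sup>2\<close> after integration.\<close>

lemma wave_integral_has_partial_derivative:
  fixes u :: "real ^ 'd \<Rightarrow> complex"
  assumes "cutoff u"
  shows "((\<lambda>t. wave_integral u (x + t *\<^sub>R axis j 1)) has_vector_derivative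
           wave_integral (\<lambda>\<xi>. \<i> * (complex_of_real (\<xi> $ j) * u \<xi>)) x) (at 0)"
proof -
  let ?e = "axis j 1 :: real ^ 'd"
  let ?D = "wave_integral (\<lambda>\<xi>. \<i> * (complex_of_real (\<xi> $ j) * u \<xi>)) x"
  let ?L = "LINT \<xi>|lborel. (\<xi> $ j)\<^sup>2 / 2 * norm (u \<xi>)"
  have cn: "continuous_on UNIV (\<lambda>\<xi>::real ^ 'd. \<xi> $ j)" by (intro continuous_intros)
  have "cutoff (\<lambda>\<xi>. (\<xi> $ j)\<^sup>2 / 2 * norm (u \<xi>))"
    using assms by (intro cutoff_continuous_mult) (auto simp: cutoff_def intro!: continuous_intros)
  then have int: "integrable lborel (\<lambda>\<xi>. (\<xi> $ j)\<^sup>2 / 2 * norm (u \<xi>))" by (rule cutoff_integrable)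
  have iu: "integrable lborel u" using assms by (rule cutoff_integrable)
  have "cutoff (\<lambda>\<xi>. \<i> * complex_of_real (\<xi> $ j) * u \<xi>)"
    using assms by (intro cutoff_continuous_mult) (auto intro!: continuous_intros)
  then have iju: "integrable lborel (\<lambda>\<xi>. \<i> * (complex_of_real (\<xi> $ j) * u \<xi>))"
    using cutoff_integrable by (simp add: mult.assoc)
  have bound: "norm (wave_integral u (x + t *\<^sub>R ?e) - wave_integral u x - t *\<^sub>R ?D) \<le> t\<^sup>2 * ?L" for t
  proof -
    let ?f = "\<lambda>\<xi>. cis ((x + t *\<^sub>R ?e) \<bullet> \<xi>) * u \<xi> - cis (x \<bullet> \<xi>) * u \<xi>
        - t *\<^sub>R (cis (x \<bullet> \<xi>) * (\<i> * (complex_of_real (\<xi> $ j) * u \<xi>)))"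
    have if': "integrable lborel ?f"
      using wave_integrand_integrable[OF iu] wave_integrand_integrable[OF iju]
      by (intro Bochner_Integration.integrable_diff integrable_scaleR_right) auto
    have "wave_integral u (x + t *\<^sub>R ?e) - wave_integral u x - t *\<^sub>R ?D = (LINT \<xi>|lborel. ?f \<xi>)"
      unfolding wave_integral_def
      using wave_integrand_integrable[OF iu] wave_integrand_integrable[OF iju]
      by (simp add: Bochner_Integration.integral_diff)
    also have "norm \<dots> \<le> (LINT \<xi>|lborel. t\<^sup>2 * ((\<xi> $ j)\<^sup>2 / 2 * norm (u \<xi>)))"
    proof (rule Bochner_Integration.integral_norm_bound_integral[OF if'])
      show "integrable lborel (\<lambda>\<xi>. t\<^sup>2 * ((\<xi> $ j)\<^sup>2 / 2 * norm (u \<xi>)))"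
        using int by (rule integrable_mult_right)
      fix \<xi> :: "real ^ 'd"
      have "(x + t *\<^sub>R ?e) \<bullet> \<xi> = x \<bullet> \<xi> + t * \<xi> $ j"
        by (simp add: inner_add_left inner_axis')
      then have "?f \<xi> = cis (x \<bullet> \<xi>) * ((cis (t * \<xi> $ j) - 1 - \<i> * (t * \<xi> $ j)) * u \<xi>)"
        by (simp add: cis_mult[symmetric] algebra_simps scaleR_conv_of_real)
      then have "norm (?f \<xi>) = norm (cis (t * \<xi> $ j) - 1 - \<i> * (t * \<xi> $ j)) * norm (u \<xi>)"
        by (simp only: norm_mult norm_cis mult_1_left)
      also have "\<dots> \<le> (t * \<xi> $ j)\<^sup>2 / 2 * norm (u \<xi>)"
        using norm_cis_taylor[of "t * \<xi> $ j"] by (intro mult_right_mono) (auto simp del: of_real_mult)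
      finally show "norm (?f \<xi>) \<le> t\<^sup>2 * ((\<xi> $ j)\<^sup>2 / 2 * norm (u \<xi>))"
        by (simp add: power_mult_distrib)
    qed
    also have "\<dots> = t\<^sup>2 * ?L" by (rule integral_mult_right_zero)
    finally show ?thesis .
  qed
  show ?thesis
    unfolding has_vector_derivative_def has_derivative_at
  proof (intro conjI)
    show "bounded_linear (\<lambda>t. t *\<^sub>R ?D)" by (rule bounded_linear_scaleR_left)
    have "((\<lambda>t::real. \<bar>t\<bar> * ?L) \<longlongrightarrow> 0) (at 0)"
      by (auto intro!: tendsto_eq_intros)
    then show "(\<lambda>t. norm (wave_integral u (x + (0 + t) *\<^sub>R ?e) - wave_integral u (x + 0 *\<^sub>R ?e)
        - t *\<^sub>R ?D) / norm t) \<midarrow>0\<rightarrow> 0"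
    proof (rule Lim_null_comparison[rotated], intro always_eventually allI)
      fix t :: real
      show "norm (norm (wave_integral u (x + (0 + t) *\<^sub>R ?e) - wave_integral u (x + 0 *\<^sub>R ?e)
        - t *\<^sub>R ?D) / norm t) \<le> \<bar>t\<bar> * ?L"
        using bound[of t] by (cases "t = 0") (auto simp: field_simps power2_eq_square)
    qed
  qed
qed

section \<open>Gaussians and Fourier inversion\<close>

lemma lborel_product_integral:
  fixes f :: "'a::euclidean_space \<Rightarrow> real \<Rightarrow> 'b::{real_normed_field, banach, second_countable_topology}"
  assumes f: "\<And>b. b \<in> Basis \<Longrightarrow> integrable lborel (f b)"
  shows "integrable lborel (\<lambda>x. \<Prod>b\<in>Basis. f b (x \<bullet> b))"
    and "(LINT x|lborel. (\<Prod>b\<in>Basis. f b (x \<bullet> b))) = (\<Prod>b\<in>Basis. (LINT t|lborel. f b t))"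
proof -
  interpret product_sigma_finite "\<lambda>_::'a. lborel :: real measure" ..
  have [measurable]: "\<And>b. b \<in> Basis \<Longrightarrow> f b \<in> borel_measurable borel" using f by auto
  have [measurable]: "(\<lambda>x. \<Prod>b\<in>Basis. f b (x \<bullet> b)) \<in> borel_measurable borel"
    by measurable
  have coord: "(\<Prod>b\<in>Basis. f b ((\<Sum>c\<in>Basis. x c *\<^sub>R c) \<bullet> b)) = (\<Prod>b\<in>Basis. f b (x b))" for x
    by (intro prod.cong) auto
  show "integrable lborel (\<lambda>x. \<Prod>b\<in>Basis. f b (x \<bullet> b))"
    unfolding lborel_eq[where 'a = 'a]
    by (simp add: integrable_distr_eq coord product_integrable_prod f)
  show "(LINT x|lborel. (\<Prod>b\<in>Basis. f b (x \<bullet> b))) = (\<Prod>b\<in>Basis. (LINT t|lborel. f b t))"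
    unfolding lborel_eq[where 'a = 'a]
    by (simp add: integral_distr coord product_integral_prod f)
qed

definition gaussian :: "real ^ 'd \<Rightarrow> complex" where
  "gaussian x = complex_of_real (exp (- (norm x)\<^sup>2 / 2))"

lemma gaussian_borel [measurable]: "gaussian \<in> borel_measurable borel"
  unfolding gaussian_def by measurable

text \<open>Up to a factor, this is the characteristic function of the standard normal distribution.\<close>

lemma gaussian_wave_integral_1d:
  fixes y :: real
  shows "integrable lborel (\<lambda>t. cis (y * t) * complex_of_real (exp (- t\<^sup>2 / 2)))"
    and "(LINT t|lborel. cis (y * t) * complex_of_real (exp (- t\<^sup>2 / 2)))
      = complex_of_real (sqrt (2 * pi) * exp (- y\<^sup>2 / 2))"
proof -
  let ?c = "complex_of_real (sqrt (2 * pi))"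
  have eq: "cis (y * t) * complex_of_real (exp (- t\<^sup>2 / 2))
      = ?c * (std_normal_density t *\<^sub>R iexp (y * t))" for t
    by (simp add: normal_density_def cis_conv_exp scaleR_conv_of_real)
  have "integrable lborel std_normal_density" by simp
  then have "integrable lborel (\<lambda>t. std_normal_density t *\<^sub>R iexp (y * t))"
    by (rule Bochner_Integration.integrable_bound) (auto simp: norm_mult)
  then show "integrable lborel (\<lambda>t. cis (y * t) * complex_of_real (exp (- t\<^sup>2 / 2)))"
    unfolding eq by (rule integrable_mult_right)
  have "(LINT t|lborel. std_normal_density t *\<^sub>R iexp (y * t)) = char std_normal_distribution y"
    unfolding char_def by (subst integral_density) (auto simp: normal_density_nonneg)
  then have *: "(LINT t|lborel. std_normal_density t *\<^sub>R iexp (y * t)) = complex_of_real (exp (- y\<^sup>2 / 2))"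
    by (simp only: char_std_normal_distribution)
  show "(LINT t|lborel. cis (y * t) * complex_of_real (exp (- t\<^sup>2 / 2)))
      = complex_of_real (sqrt (2 * pi) * exp (- y\<^sup>2 / 2))"
    unfolding eq integral_mult_right_zero * by simp
qed

lemma norm_square_eq_sum: "(norm x)\<^sup>2 = (\<Sum>b\<in>Basis. (x \<bullet> b)\<^sup>2)"
  unfolding power2_norm_eq_inner by (subst euclidean_inner) (simp add: power2_eq_square)

lemma gaussian_wave_integral:
  fixes y :: "real ^ 'd"
  shows "integrable lborel (gaussian :: real ^ 'd \<Rightarrow> complex)"
    and "wave_integral gaussian y = complex_of_real (sqrt (2 * pi) ^ CARD('d)) * gaussian y"
proof -
  let ?f = "\<lambda>(y::real ^ 'd) b t. cis ((y \<bullet> b) * t) * complex_of_real (exp (- t\<^sup>2 / 2))"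
  have gaussian: "gaussian x = (\<Prod>b\<in>Basis. complex_of_real (exp (- (x \<bullet> b)\<^sup>2 / 2)))" for x :: "real ^ 'd"
    by (simp add: gaussian_def norm_square_eq_sum exp_sum[symmetric] sum_negf sum_divide_distrib
      flip: of_real_prod)
  have cis_inner: "cis (y \<bullet> x) = (\<Prod>b\<in>Basis. cis ((y \<bullet> b) * (x \<bullet> b)))" for x y :: "real ^ 'd"
    by (subst euclidean_inner) (simp add: cis_conv_exp sum_distrib_left exp_sum)
  have eq: "cis (y \<bullet> x) * gaussian x = (\<Prod>b\<in>Basis. ?f y b (x \<bullet> b))" for x y :: "real ^ 'd"
    by (simp only: gaussian cis_inner prod.distrib)
  have "integrable lborel (\<lambda>x::real ^ 'd. cis (0 \<bullet> x) * gaussian x)"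
    unfolding eq by (intro lborel_product_integral gaussian_wave_integral_1d)
  then show "integrable lborel (gaussian :: real ^ 'd \<Rightarrow> complex)" by simp
  have "wave_integral gaussian y = (\<Prod>b\<in>Basis. (LINT t|lborel. ?f y b t))"
    unfolding wave_integral_def eq by (intro lborel_product_integral gaussian_wave_integral_1d)
  also have "\<dots> = complex_of_real (sqrt (2 * pi) ^ CARD('d)) * gaussian y"
    unfolding gaussian_wave_integral_1d gaussian of_real_mult prod.distrib by simp
  finally show "wave_integral gaussian y = complex_of_real (sqrt (2 * pi) ^ CARD('d)) * gaussian y" .
qed

lemma norm_gaussian_le_1: "norm (gaussian x) \<le> 1"
  by (simp add: gaussian_def)

lemma continuous_gaussian: "continuous_on UNIV gaussian"
  unfolding gaussian_def by (intro continuous_intros) simp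

text \<open>Inserting the factor \<open>gaussian (\<epsilon> *\<^sub>R x)\<close> makes the double integral absolutely convergent. By Fubini's
  theorem the inner integral becomes the transform of a dilated Gaussian, again a Gaussian, which
  concentrates at \<open>\<xi>\<close> as \<open>\<epsilon>\<close> tends to 0; the substitution \<open>\<eta> = \<xi> + \<epsilon> *\<^sub>R z\<close> removes the powers of \<open>\<epsilon>\<close>.\<close>

lemma gaussian_mean_eq:
  fixes u :: "real ^ 'd \<Rightarrow> complex"
  assumes u: "cutoff u" and "\<epsilon> > 0"
  shows "(LINT x|lborel. cis (- \<xi> \<bullet> x) * wave_integral u x * gaussian (\<epsilon> *\<^sub>R x))
    = complex_of_real (sqrt (2 * pi) ^ CARD('d)) * (LINT z|lborel. u (\<xi> + \<epsilon> *\<^sub>R z) * gaussian z)"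
proof -
  have [measurable]: "u \<in> borel_measurable borel" using u by measurable
  have iu: "integrable lborel u" using u by (rule cutoff_integrable)
  let ?S = "complex_of_real (sqrt (2 * pi) ^ CARD('d))"
  let ?F = "\<lambda>\<eta> x. u \<eta> * (cis ((\<eta> - \<xi>) \<bullet> x) * gaussian (\<epsilon> *\<^sub>R x))"
  have ig: "integrable lborel (\<lambda>x::real ^ 'd. gaussian (\<epsilon> *\<^sub>R x))"
    using lborel_integrable_affine[OF gaussian_wave_integral(1), of \<epsilon> 0] \<open>\<epsilon> > 0\<close> by simp
  have norm_F: "norm (?F \<eta> x) = norm (u \<eta>) * norm (gaussian (\<epsilon> *\<^sub>R x))" for \<eta> x
    by (simp add: norm_mult)
  have "continuous_on UNIV (\<lambda>p::(real ^ 'd) \<times> (real ^ 'd). cis ((fst p - \<xi>) \<bullet> snd p))"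
    by (intro continuous_intros)
  then have [measurable]: "(\<lambda>p::(real ^ 'd) \<times> (real ^ 'd). cis ((fst p - \<xi>) \<bullet> snd p)) \<in> borel_measurable (borel \<Otimes>\<^sub>M borel)"
    unfolding borel_prod by (rule borel_measurable_continuous_onI)
  have "case_prod ?F \<in> borel_measurable (borel \<Otimes>\<^sub>M borel)"
    unfolding case_prod_beta by measurable
  then have meas: "case_prod ?F \<in> borel_measurable (lborel \<Otimes>\<^sub>M lborel)"
    by (simp cong: measurable_cong_sets sets_pair_measure_cong)
  have int: "integrable (lborel \<Otimes>\<^sub>M lborel) (case_prod ?F)"
  proof (rule lborel_pair.Fubini_integrable[OF meas])
    show "integrable lborel (\<lambda>\<eta>. LINT x|lborel. norm (case_prod ?F (\<eta>, x)))"
      using iu by (simp add: norm_F)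
    show "AE \<eta> in lborel. integrable lborel (\<lambda>x. case_prod ?F (\<eta>, x))"
      using wave_integrand_integrable[OF ig] by simp
  qed
  have "(LINT x|lborel. cis (- \<xi> \<bullet> x) * wave_integral u x * gaussian (\<epsilon> *\<^sub>R x))
      = (LINT x|lborel. LINT \<eta>|lborel. ?F \<eta> x)"
  proof (rule Bochner_Integration.integral_cong[OF refl])
    fix x :: "real ^ 'd"
    have "(\<eta> - \<xi>) \<bullet> x = - \<xi> \<bullet> x + x \<bullet> \<eta>" for \<eta>
      by (simp add: inner_diff_left inner_commute[of x])
    then have F: "?F \<eta> x = (cis (- \<xi> \<bullet> x) * gaussian (\<epsilon> *\<^sub>R x)) * (cis (x \<bullet> \<eta>) * u \<eta>)" for \<eta>
      by (simp only: cis_mult[symmetric] mult_ac)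
    show "cis (- \<xi> \<bullet> x) * wave_integral u x * gaussian (\<epsilon> *\<^sub>R x) = (LINT \<eta>|lborel. ?F \<eta> x)"
      unfolding F integral_mult_right_zero wave_integral_def by (simp only: mult_ac)
  qed
  also have "\<dots> = (LINT \<eta>|lborel. LINT x|lborel. ?F \<eta> x)"
    by (rule lborel_pair.Fubini_integral[OF int])
  also have "\<dots> = (LINT \<eta>|lborel. u \<eta> * (complex_of_real ((1 / \<epsilon>) ^ CARD('d))
      * (?S * gaussian ((1 / \<epsilon>) *\<^sub>R (\<eta> - \<xi>)))))"
    using wave_integral_scaled[OF gaussian_borel, of \<epsilon>, where 'd = 'd] \<open>\<epsilon> > 0\<close>
    by (simp add: gaussian_wave_integral(2) wave_integral_def[symmetric])
  also have "\<dots> = complex_of_real ((1 / \<epsilon>) ^ CARD('d)) * ?S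
      * (LINT \<eta>|lborel. u \<eta> * gaussian ((1 / \<epsilon>) *\<^sub>R (\<eta> - \<xi>)))"
    by (simp only: integral_mult_right_zero[symmetric] mult_ac)
  also have "(LINT \<eta>|lborel. u \<eta> * gaussian ((1 / \<epsilon>) *\<^sub>R (\<eta> - \<xi>)))
      = \<epsilon> ^ CARD('d) *\<^sub>R (LINT z|lborel. u (\<xi> + \<epsilon> *\<^sub>R z) * gaussian z)"
    using \<open>\<epsilon> > 0\<close> by (subst lborel_integral_affine[where c = \<epsilon> and t = \<xi>]) auto
  finally show ?thesis
    using \<open>\<epsilon> > 0\<close> by (simp add: scaleR_conv_of_real[where 'a = complex] power_divide)
qed

text \<open>Let \<open>\<epsilon>\<close> tend to 0 in the preceding identity: the left-hand side converges by integrability of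
  \<open>wave_integral u\<close>, the right-hand side by continuity and boundedness of \<open>u\<close>. The factor
  \<open>sqrt (2 * pi)\<close> to the power of the dimension arises twice, from the transform of the Gaussian and from its integral.\<close>

theorem wave_integral_inversion:
  fixes u :: "real ^ 'd \<Rightarrow> complex"
  assumes u: "cutoff u" and cont: "continuous_on UNIV u"
    and int: "integrable lborel (wave_integral u)"
  shows "wave_integral (wave_integral u) (- \<xi>) = complex_of_real ((2 * pi) ^ CARD('d)) * u \<xi>"
proof -
  let ?S = "complex_of_real (sqrt (2 * pi) ^ CARD('d))"
  let ?e = "\<lambda>n. 1 / real (Suc n)"
  have [measurable]: "u \<in> borel_measurable borel" "wave_integral u \<in> borel_measurable borel"
    using u int by auto
  obtain B where B: "\<And>\<xi>. norm (u \<xi>) \<le> B" using u by (auto simp: cutoff_def)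
  have e0: "?e \<longlonglongrightarrow> 0" by (rule LIMSEQ_Suc[OF lim_1_over_n])
  have scale0: "(\<lambda>n. ?e n *\<^sub>R x) \<longlonglongrightarrow> 0" for x :: "real ^ 'd"
    using tendsto_scaleR[OF e0 tendsto_const[of x]] by simp
  have lim1: "(\<lambda>n. LINT x|lborel. cis (- \<xi> \<bullet> x) * wave_integral u x * gaussian (?e n *\<^sub>R x))
      \<longlonglongrightarrow> (LINT x|lborel. cis (- \<xi> \<bullet> x) * wave_integral u x)"
  proof (rule integral_dominated_convergence[where w = "\<lambda>x. norm (wave_integral u x)"])
    show "integrable lborel (\<lambda>x. norm (wave_integral u x))" using int by simp
    show "AE x in lborel. (\<lambda>n. cis (- \<xi> \<bullet> x) * wave_integral u x * gaussian (?e n *\<^sub>R x))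
        \<longlonglongrightarrow> cis (- \<xi> \<bullet> x) * wave_integral u x"
    proof (rule AE_I2)
      fix x :: "real ^ 'd"
      have "(\<lambda>n. gaussian (?e n *\<^sub>R x)) \<longlonglongrightarrow> gaussian (0 :: real ^ 'd)"
        using continuous_on_tendsto_compose[OF continuous_gaussian scale0[of x]] by simp
      from tendsto_mult[OF tendsto_const this]
      show "(\<lambda>n. cis (- \<xi> \<bullet> x) * wave_integral u x * gaussian (?e n *\<^sub>R x))
        \<longlonglongrightarrow> cis (- \<xi> \<bullet> x) * wave_integral u x" by (simp add: gaussian_def)
    qed
    show "AE x in lborel. norm (cis (- \<xi> \<bullet> x) * wave_integral u x * gaussian (?e n *\<^sub>R x))
        \<le> norm (wave_integral u x)" for n
      by (auto simp: norm_mult intro!: mult_left_le norm_gaussian_le_1)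
  qed measurable
  have lim2: "(\<lambda>n. LINT z|lborel. u (\<xi> + ?e n *\<^sub>R z) * gaussian z)
      \<longlonglongrightarrow> (LINT z|(lborel :: (real ^ 'd) measure). u \<xi> * gaussian z)"
  proof (rule integral_dominated_convergence[where w = "\<lambda>z. B * norm (gaussian z)"])
    show "integrable lborel (\<lambda>z::real ^ 'd. B * norm (gaussian z))"
      by (intro integrable_mult_right integrable_norm gaussian_wave_integral(1))
    show "AE z in lborel. (\<lambda>n. u (\<xi> + ?e n *\<^sub>R z) * gaussian z) \<longlonglongrightarrow> u \<xi> * gaussian z"
    proof (rule AE_I2)
      fix z :: "real ^ 'd"
      have "(\<lambda>n. \<xi> + ?e n *\<^sub>R z) \<longlonglongrightarrow> \<xi>"
        using tendsto_add[OF tendsto_const scale0[of z], of \<xi>] by simp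
      then have "(\<lambda>n. u (\<xi> + ?e n *\<^sub>R z)) \<longlonglongrightarrow> u \<xi>"
        by (rule continuous_on_tendsto_compose[OF cont]) auto
      then show "(\<lambda>n. u (\<xi> + ?e n *\<^sub>R z) * gaussian z) \<longlonglongrightarrow> u \<xi> * gaussian z"
        by (intro tendsto_intros)
    qed
    show "AE z in lborel. norm (u (\<xi> + ?e n *\<^sub>R z) * gaussian z) \<le> B * norm (gaussian z)" for n
      using B by (auto simp: norm_mult intro!: mult_right_mono)
  qed measurable
  have "(LINT z|(lborel :: (real ^ 'd) measure). u \<xi> * gaussian z) = u \<xi> * wave_integral gaussian (0 :: real ^ 'd)"
    by (simp add: wave_integral_def)
  also have "\<dots> = u \<xi> * ?S"
    by (simp add: gaussian_wave_integral(2) gaussian_def)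
  finally have I: "(LINT z|(lborel :: (real ^ 'd) measure). u \<xi> * gaussian z) = u \<xi> * ?S" .
  have lim2': "(\<lambda>n. ?S * (LINT z|lborel. u (\<xi> + ?e n *\<^sub>R z) * gaussian z)) \<longlonglongrightarrow> ?S * (u \<xi> * ?S)"
    using lim2 unfolding I by (intro tendsto_mult tendsto_const)
  have "(\<lambda>n. LINT x|lborel. cis (- \<xi> \<bullet> x) * wave_integral u x * gaussian (?e n *\<^sub>R x))
      = (\<lambda>n. ?S * (LINT z|lborel. u (\<xi> + ?e n *\<^sub>R z) * gaussian z))"
    by (rule ext) (rule gaussian_mean_eq[OF u], simp)
  then have "(LINT x|lborel. cis (- \<xi> \<bullet> x) * wave_integral u x) = ?S * (u \<xi> * ?S)"
    using LIMSEQ_unique[OF lim1] lim2' by (simp only:)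
  moreover have "?S * ?S = complex_of_real ((2 * pi) ^ CARD('d))"
    by (simp only: of_real_mult[symmetric] power_mult_distrib[symmetric]) simp
  ultimately show ?thesis
    unfolding wave_integral_def[of "wave_integral u"] by (simp only: mult.left_commute mult.commute)
qed

section \<open>Derivatives on the frequency side\<close>

lemma wave_integral_translate:
  fixes u :: "real ^ 'd \<Rightarrow> complex"
  assumes [measurable]: "u \<in> borel_measurable borel"
  shows "wave_integral (\<lambda>\<xi>. u (h + \<xi>)) x = cis (- (x \<bullet> h)) * wave_integral u x"
proof -
  have "cis (x \<bullet> \<xi>) * u (h + \<xi>) = cis (- (x \<bullet> h)) * (cis (x \<bullet> (h + \<xi>)) * u (h + \<xi>))" for \<xi>
    by (simp add: inner_add_right cis_mult mult.assoc[symmetric])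
  then have "wave_integral (\<lambda>\<xi>. u (h + \<xi>)) x
      = cis (- (x \<bullet> h)) * (LINT \<xi>|lborel. cis (x \<bullet> (h + \<xi>)) * u (h + \<xi>))"
    unfolding wave_integral_def integral_mult_right_zero[symmetric]
    by (intro Bochner_Integration.integral_cong refl)
  also have "(LINT \<xi>|lborel. cis (x \<bullet> (h + \<xi>)) * u (h + \<xi>)) = wave_integral u x"
    unfolding wave_integral_def
    by (rule lborel_integral_translate[where f = "\<lambda>\<xi>. cis (x \<bullet> \<xi>) * u \<xi>"]) measurable
  finally show ?thesis .
qed

lemma cutoffI_continuous:
  fixes u :: "real ^ 'd \<Rightarrow> 'b::{real_normed_vector, second_countable_topology}"
  assumes cont: "continuous_on UNIV u" and R: "\<And>\<xi>. R < norm \<xi> \<Longrightarrow> u \<xi> = 0"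
  shows "cutoff u"
proof -
  have "compact (u ` cball 0 R)"
    by (intro compact_continuous_image continuous_on_subset[OF cont] compact_cball) auto
  then have "bounded (u ` cball 0 R)" by (rule compact_imp_bounded)
  then obtain B where "\<forall>y\<in>u ` cball 0 R. norm y \<le> B"
    unfolding bounded_iff by blast
  then have B: "\<And>\<xi>. norm \<xi> \<le> R \<Longrightarrow> norm (u \<xi>) \<le> B" by simp
  have "norm (u \<xi>) \<le> max B 0" for \<xi>
    using B[of \<xi>] R[of \<xi>] by (cases "norm \<xi> \<le> R") auto
  moreover have "u \<in> borel_measurable borel"
    using cont by (rule borel_measurable_continuous_onI)
  ultimately show ?thesis
    using R unfolding cutoff_def by blast
qed

lemma frechet_derivative_eq_0_outside:
  fixes u :: "real ^ 'd \<Rightarrow> real"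
  assumes R: "\<And>\<xi>. R < norm \<xi> \<Longrightarrow> u \<xi> = 0" and "R < norm \<xi>"
  shows "frechet_derivative u (at \<xi>) v = 0"
proof -
  have "open {\<xi>::real ^ 'd. R < norm \<xi>}"
    by (intro open_Collect_less continuous_intros)
  then have "(u has_derivative (\<lambda>_. 0)) (at \<xi>)"
  proof (rule has_derivative_transform_within_open[rotated])
    show "((\<lambda>_. 0) has_derivative (\<lambda>_. 0 :: real)) (at \<xi>)" by (rule has_derivative_const)
  qed (use R \<open>R < norm \<xi>\<close> in auto)
  from fun_cong[OF frechet_derivative_at[OF this]] show ?thesis by (rule sym)
qed

lemma has_derivative_along_line:
  fixes u :: "real ^ 'd \<Rightarrow> real"
  assumes "u differentiable (at (\<xi> + t *\<^sub>R v))"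
  shows "((\<lambda>t. u (\<xi> + t *\<^sub>R v)) has_real_derivative frechet_derivative u (at (\<xi> + t *\<^sub>R v)) v) (at t)"
proof -
  let ?D = "frechet_derivative u (at (\<xi> + t *\<^sub>R v))"
  have u: "(u has_derivative ?D) (at (\<xi> + t *\<^sub>R v))"
    using assms by (simp add: frechet_derivative_works)
  have "((\<lambda>t. \<xi> + t *\<^sub>R v) has_derivative (\<lambda>s. s *\<^sub>R v)) (at t)"
    by (auto intro!: derivative_eq_intros)
  from has_derivative_compose[OF this u]
  have "((\<lambda>t. u (\<xi> + t *\<^sub>R v)) has_derivative (\<lambda>s. ?D (s *\<^sub>R v))) (at t)" .
  moreover have "(\<lambda>s. ?D (s *\<^sub>R v)) = (\<lambda>s. ?D v * s)"
    using linear_scale[OF linear_frechet_derivative[OF assms]] by (simp add: fun_eq_iff mult.commute)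
  ultimately show ?thesis by (simp add: has_field_derivative_def)
qed

text \<open>Instead of integrating by parts, translate: the difference quotient of \<open>u\<close> in direction \<open>v\<close> has
  transform \<open>(cis (- t * (x \<bullet> v)) - 1) / t\<close> times that of \<open>u\<close>. As \<open>t\<close> tends to 0 the difference
  quotients converge boundedly on a fixed ball. At \<open>x = 0\<close> the result says that the integral of a
  directional derivative is 0.\<close>

lemma wave_integral_frechet_derivative:
  fixes u :: "real ^ 'd \<Rightarrow> real" and v :: "real ^ 'd"
  assumes diff: "\<And>\<xi>. u differentiable (at \<xi>)"
    and cont: "continuous_on UNIV (\<lambda>\<xi>. frechet_derivative u (at \<xi>) v)"
    and R: "\<And>\<xi>. R < norm \<xi> \<Longrightarrow> u \<xi> = 0"
  shows "wave_integral (\<lambda>\<xi>. complex_of_real (frechet_derivative u (at \<xi>) v)) x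
    = - \<i> * complex_of_real (x \<bullet> v) * wave_integral (\<lambda>\<xi>. complex_of_real (u \<xi>)) x"
proof -
  let ?w = "\<lambda>\<xi>. frechet_derivative u (at \<xi>) v"
  let ?u = "\<lambda>\<xi>. complex_of_real (u \<xi>)"
  let ?e = "\<lambda>n. 1 / real (Suc n)"
  let ?D = "\<lambda>n \<xi>. complex_of_real ((u (?e n *\<^sub>R v + \<xi>) - u \<xi>) / ?e n)"
  \<comment> \<open>as the step sizes are at most 1, all difference quotients vanish outside this radius\<close>
  let ?R = "R + norm v"
  have cu: "continuous_on UNIV u"
    using diff by (simp add: continuous_at_imp_continuous_on differentiable_imp_continuous_within)
  have "cutoff u" using cu R by (rule cutoffI_continuous)
  then have iu: "integrable lborel ?u" by (intro cutoff_integrable cutoff_of_real)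
  have cw: "cutoff ?w"
    using cont frechet_derivative_eq_0_outside[of R u] R by (intro cutoffI_continuous) auto
  have [measurable]: "u \<in> borel_measurable borel" "?w \<in> borel_measurable borel"
    using \<open>cutoff u\<close> cw by measurable
  obtain B where B: "\<And>\<xi>. norm (?w \<xi>) \<le> B" using cw by (auto simp: cutoff_def)
  have e0: "?e \<longlonglongrightarrow> 0" by (rule LIMSEQ_Suc[OF lim_1_over_n])
  have line: "((\<lambda>t. u (\<xi> + t *\<^sub>R v)) has_real_derivative ?w (\<xi> + t *\<^sub>R v)) (at t)" for \<xi> t
    using diff by (rule has_derivative_along_line)
  have bound: "norm (?D n \<xi>) \<le> B * indicator (cball 0 ?R) \<xi>" for n \<xi>
  proof (cases "norm \<xi> \<le> ?R")
    case True
    obtain z where "u (\<xi> + ?e n *\<^sub>R v) - u (\<xi> + 0 *\<^sub>R v) = (?e n - 0) * ?w (\<xi> + z *\<^sub>R v)"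
      using MVT2[of 0 "?e n" "\<lambda>t. u (\<xi> + t *\<^sub>R v)" "\<lambda>t. ?w (\<xi> + t *\<^sub>R v)"] line by auto
    then have "?D n \<xi> = complex_of_real (?w (\<xi> + z *\<^sub>R v))" by (simp add: add.commute)
    then show ?thesis using B True by simp
  next
    case False
    have "norm \<xi> \<le> norm (?e n *\<^sub>R v + \<xi>) + norm (?e n *\<^sub>R v)"
      by (metis add_diff_cancel_left' norm_triangle_ineq4 add.commute)
    moreover have "norm (?e n *\<^sub>R v) \<le> norm v" by (auto simp: field_simps)
    ultimately have "R < norm (?e n *\<^sub>R v + \<xi>)" "R < norm \<xi>" using False norm_ge_zero[of v] by linarith+
    then show ?thesis using R False by simp
  qed
  have "(\<lambda>n. wave_integral (?D n) x) \<longlonglongrightarrow> wave_integral (\<lambda>\<xi>. complex_of_real (?w \<xi>)) x"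
    unfolding wave_integral_def
  proof (rule integral_dominated_convergence[where w = "\<lambda>\<xi>. B * indicator (cball 0 ?R) \<xi>"])
    show "integrable lborel (\<lambda>\<xi>. B * indicator (cball (0::real ^ 'd) ?R) \<xi>)"
      using emeasure_bounded_finite[of "cball (0::real ^ 'd) ?R"]
      by (intro integrable_mult_right integrable_real_indicator) auto
    show "AE \<xi> in lborel. norm (cis (x \<bullet> \<xi>) * ?D n \<xi>) \<le> B * indicator (cball 0 ?R) \<xi>" for n
      using bound[of n] by (simp only: norm_mult norm_cis mult_1_left) simp
    show "AE \<xi> in lborel. (\<lambda>n. cis (x \<bullet> \<xi>) * ?D n \<xi>) \<longlonglongrightarrow> cis (x \<bullet> \<xi>) * complex_of_real (?w \<xi>)"
    proof (intro AE_I2 tendsto_mult tendsto_const tendsto_of_real)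
      fix \<xi> :: "real ^ 'd"
      have "(\<lambda>h. (u (\<xi> + h *\<^sub>R v) - u \<xi>) / h) \<midarrow>0\<rightarrow> ?w \<xi>"
        using line[of \<xi> 0] by (simp add: DERIV_def)
      moreover have "filterlim ?e (at 0) sequentially"
        using e0 by (auto simp: filterlim_at)
      ultimately have "(\<lambda>n. (u (\<xi> + ?e n *\<^sub>R v) - u \<xi>) / ?e n) \<longlonglongrightarrow> ?w \<xi>"
        by (rule filterlim_compose)
      then show "(\<lambda>n. (u (?e n *\<^sub>R v + \<xi>) - u \<xi>) / ?e n) \<longlonglongrightarrow> ?w \<xi>"
        by (simp add: add.commute)
    qed
  qed measurable
  moreover have "(\<lambda>n. wave_integral (?D n) x) \<longlonglongrightarrow> (- \<i> * complex_of_real (x \<bullet> v)) * wave_integral ?u x"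
  proof -
    let ?q = "\<lambda>n. (cis (- ?e n * (x \<bullet> v)) - 1) / complex_of_real (?e n)"
    have "wave_integral (?D n) x = ?q n * wave_integral ?u x" for n
    proof -
      have ish: "integrable lborel (\<lambda>\<xi>. ?u (?e n *\<^sub>R v + \<xi>))"
        using lborel_integrable_affine[OF iu, of 1 "?e n *\<^sub>R v"] by simp
      have "wave_integral (?D n) x = (LINT \<xi>|lborel. (1 / complex_of_real (?e n)) *
          (cis (x \<bullet> \<xi>) * ?u (?e n *\<^sub>R v + \<xi>) - cis (x \<bullet> \<xi>) * ?u \<xi>))"
        unfolding wave_integral_def by (intro Bochner_Integration.integral_cong) (auto simp: field_simps)
      also have "\<dots> = (1 / complex_of_real (?e n)) *
          (wave_integral (\<lambda>\<xi>. ?u (?e n *\<^sub>R v + \<xi>)) x - wave_integral ?u x)"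
        unfolding integral_mult_right_zero wave_integral_def
        by (subst Bochner_Integration.integral_diff[OF wave_integrand_integrable[OF ish] wave_integrand_integrable[OF iu]]) simp
      also have "wave_integral (\<lambda>\<xi>. ?u (?e n *\<^sub>R v + \<xi>)) x = cis (- ?e n * (x \<bullet> v)) * wave_integral ?u x"
        by (subst wave_integral_translate) auto
      finally show ?thesis by (simp add: field_simps)
    qed
    moreover have "?q \<longlonglongrightarrow> - \<i> * complex_of_real (x \<bullet> v)"
    proof (rule LIM_zero_cancel, rule Lim_null_comparison)
      have "(\<lambda>n. ?e n * ((x \<bullet> v)\<^sup>2 / 2)) \<longlonglongrightarrow> 0 * ((x \<bullet> v)\<^sup>2 / 2)"
        by (intro tendsto_mult e0 tendsto_const)
      then show "(\<lambda>n. ?e n * ((x \<bullet> v)\<^sup>2 / 2)) \<longlonglongrightarrow> 0" by simp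
      show "\<forall>\<^sub>F n in sequentially. norm (?q n - - \<i> * complex_of_real (x \<bullet> v)) \<le> ?e n * ((x \<bullet> v)\<^sup>2 / 2)"
      proof (intro always_eventually allI)
        fix n
        let ?s = "- ?e n * (x \<bullet> v)"
        have "(cis r - 1) / complex_of_real e - - \<i> * complex_of_real (x \<bullet> v)
            = (cis r - 1 - \<i> * complex_of_real (- e * (x \<bullet> v))) / complex_of_real e" if "e \<noteq> 0" for e r
          using that by (simp add: field_simps)
        from this[of "?e n" ?s]
        have "?q n - - \<i> * complex_of_real (x \<bullet> v) = (cis ?s - 1 - \<i> * complex_of_real ?s) / complex_of_real (?e n)"
          by simp
        also have "norm \<dots> = norm (cis ?s - 1 - \<i> * complex_of_real ?s) / ?e n"
          by (simp only: norm_divide norm_of_real) simp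
        also have "\<dots> \<le> (?s\<^sup>2 / 2) / ?e n"
          by (intro divide_right_mono norm_cis_taylor) simp
        also have "\<dots> = ?e n * ((x \<bullet> v)\<^sup>2 / 2)"
          by (simp only: power_mult_distrib power2_minus) (simp add: power2_eq_square)
        finally show "norm (?q n - - \<i> * complex_of_real (x \<bullet> v)) \<le> ?e n * ((x \<bullet> v)\<^sup>2 / 2)" .
      qed
    qed
    ultimately show ?thesis by (simp only:) (intro tendsto_mult tendsto_const)
  qed
  ultimately show ?thesis by (rule LIMSEQ_unique)
qed

section \<open>Test functions and decay of their transforms\<close>

definition test_function :: "(real ^ 'd \<Rightarrow> real) \<Rightarrow> bool" where
  "test_function u \<longleftrightarrow> smooth u \<and> (\<exists>R. \<forall>\<xi>. R < norm \<xi> \<longrightarrow> u \<xi> = 0)"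

lemma Ck_continuous: "Ck k u \<Longrightarrow> continuous_on UNIV u"
  by (cases k) (auto simp: continuous_at_imp_continuous_on differentiable_imp_continuous_within)

lemma Ck_SucD: "Ck (Suc k) u \<Longrightarrow> Ck k u"
proof (induction k arbitrary: u)
  case 0
  then show ?case using Ck_continuous[OF 0] by simp
next
  case (Suc k)
  show ?case
    unfolding Ck.simps(2)[of k u]
    using Suc.prems[unfolded Ck.simps(2)[of "Suc k" u]] Suc.IH by blast
qed

lemma Ck_add: "Ck k u \<Longrightarrow> Ck k w \<Longrightarrow> Ck k (\<lambda>x. u x + w x)"
proof (induction k arbitrary: u w)
  case (Suc k)
  have D: "((\<lambda>x. u x + w x) has_derivative
      (\<lambda>v. frechet_derivative u (at x) v + frechet_derivative w (at x) v)) (at x)" for x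
    using Suc.prems by (intro has_derivative_add) (simp_all add: frechet_derivative_works)
  have "(\<lambda>x. u x + w x) differentiable (at x)" for x
    using D by (rule differentiableI)
  moreover have "frechet_derivative (\<lambda>x. u x + w x) (at x) v
      = frechet_derivative u (at x) v + frechet_derivative w (at x) v" for x v
    by (rule fun_cong[OF frechet_derivative_at[OF D[of x], symmetric]])
  ultimately show ?case using Suc by simp
qed (simp add: continuous_on_add)

lemma Ck_cmult: "Ck k u \<Longrightarrow> Ck k (\<lambda>x. c * u x)"
proof (induction k arbitrary: u)
  case (Suc k)
  have D: "((\<lambda>x. c * u x) has_derivative (\<lambda>v. c * frechet_derivative u (at x) v)) (at x)" for x
    using Suc.prems by (intro has_derivative_mult_right) (simp add: frechet_derivative_works)
  have "(\<lambda>x. c * u x) differentiable (at x)" for x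
    using D by (rule differentiableI)
  moreover have "frechet_derivative (\<lambda>x. c * u x) (at x) v = c * frechet_derivative u (at x) v" for x v
    by (rule fun_cong[OF frechet_derivative_at[OF D[of x], symmetric]])
  ultimately show ?case using Suc by simp
qed (simp add: continuous_on_mult_left)

text \<open>The derivative of the product in direction \<open>v\<close> is \<open>x $ i\<close> times the derivative of \<open>u\<close> plus \<open>v $ i\<close>
  times \<open>u\<close>, so the induction has to run over all \<open>u\<close>.\<close>

lemma Ck_coordinate_mult:
  fixes u :: "real ^ 'd \<Rightarrow> real"
  shows "Ck k u \<Longrightarrow> Ck k (\<lambda>x. x $ i * u x)"
proof (induction k arbitrary: u)
  case 0
  then show ?case by (auto intro!: continuous_intros)
next
  case (Suc k)
  have D: "((\<lambda>x. x $ i * u x) has_derivative (\<lambda>v. x $ i * frechet_derivative u (at x) v + v $ i * u x)) (at x)" for x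
  proof (rule has_derivative_mult)
    show "((\<lambda>x. x $ i) has_derivative (\<lambda>v. v $ i)) (at x)"
      by (rule bounded_linear_imp_has_derivative) (rule bounded_linear_vec_nth)
    show "(u has_derivative frechet_derivative u (at x)) (at x)"
      using Suc.prems by (simp add: frechet_derivative_works)
  qed
  have "(\<lambda>x. x $ i * u x) differentiable (at x)" for x
    using D by (rule differentiableI)
  moreover have "frechet_derivative (\<lambda>x. x $ i * u x) (at x) v
      = x $ i * frechet_derivative u (at x) v + v $ i * u x" for x v
    by (rule fun_cong[OF frechet_derivative_at[OF D[of x], symmetric]])
  ultimately show ?case
    using Suc.prems Suc.IH[of "\<lambda>x. frechet_derivative u (at x) v" for v] Ck_SucD[OF Suc.prems]
    by (auto intro!: Ck_add Ck_cmult)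
qed

lemma test_function_coordinate_mult:
  assumes "test_function u" shows "test_function (\<lambda>\<xi>. \<xi> $ i * u \<xi>)"
  using assms Ck_coordinate_mult unfolding test_function_def smooth_def by fastforce

lemma test_function_frechet_derivative:
  assumes "test_function u" shows "test_function (\<lambda>\<xi>. frechet_derivative u (at \<xi>) v)"
proof -
  obtain R where "\<And>\<xi>. R < norm \<xi> \<Longrightarrow> u \<xi> = 0" and u: "\<And>k. Ck k u"
    using assms by (auto simp: test_function_def smooth_def)
  then have "\<And>\<xi>. R < norm \<xi> \<Longrightarrow> frechet_derivative u (at \<xi>) v = 0"
    by (intro frechet_derivative_eq_0_outside)
  moreover have "Ck k (\<lambda>\<xi>. frechet_derivative u (at \<xi>) v)" for k
    using u[of "Suc k"] by simp
  ultimately show ?thesis by (auto simp: test_function_def smooth_def)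
qed

lemma test_function_continuous: "test_function u \<Longrightarrow> continuous_on UNIV u"
  using Ck_continuous by (auto simp: test_function_def smooth_def)

lemma test_function_cutoff: "test_function u \<Longrightarrow> cutoff u"
  using cutoffI_continuous[OF test_function_continuous, of u] by (auto simp: test_function_def)

lemma test_function_cutoff_complex: "test_function u \<Longrightarrow> cutoff (\<lambda>\<xi>. complex_of_real (u \<xi>))"
  by (intro cutoff_of_real test_function_cutoff)

lemma wave_integral_test_function_derivative:
  assumes "test_function u"
  shows "wave_integral (\<lambda>\<xi>. complex_of_real (frechet_derivative u (at \<xi>) v)) x
    = - \<i> * complex_of_real (x \<bullet> v) * wave_integral (\<lambda>\<xi>. complex_of_real (u \<xi>)) x"
proof -
  obtain R where R: "\<And>\<xi>. R < norm \<xi> \<Longrightarrow> u \<xi> = 0"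
    using assms by (auto simp: test_function_def)
  have u: "Ck (Suc 0) u" using assms unfolding test_function_def smooth_def by blast
  show ?thesis
    using u test_function_continuous[OF test_function_frechet_derivative[OF assms]] R
    by (intro wave_integral_frechet_derivative) auto
qed

text \<open>Each factor \<open>x \<bullet> v\<close> is absorbed into one derivative of \<open>u\<close> in direction \<open>v\<close>.\<close>

lemma wave_integral_decay:
  assumes "test_function u"
  shows "\<exists>C. \<forall>x. \<bar>x \<bullet> v\<bar> ^ N * norm (wave_integral (\<lambda>\<xi>. complex_of_real (u \<xi>)) x) \<le> C"
  using assms
proof (induction N arbitrary: u)
  case 0
  show ?case using wave_integral_norm_le by (auto intro!: exI)
next
  case (Suc N)
  obtain C where "\<bar>x \<bullet> v\<bar> ^ N * norm (wave_integral (\<lambda>\<xi>. complex_of_real (frechet_derivative u (at \<xi>) v)) x) \<le> C" for x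
    using Suc.IH[OF test_function_frechet_derivative[OF Suc.prems]] by blast
  then show ?case
    unfolding wave_integral_test_function_derivative[OF Suc.prems]
    by (intro exI[of _ C]) (simp add: norm_mult mult_ac)
qed

lemma integrable_prod_cauchy:
  "integrable lborel (\<lambda>x::'a::euclidean_space. \<Prod>b\<in>Basis. inverse (1 + (x \<bullet> b)\<^sup>2))"
proof (rule lborel_product_integral(1)[where f = "\<lambda>_ t. inverse (1 + t\<^sup>2)"])
  show "integrable lborel (\<lambda>t::real. inverse (1 + t\<^sup>2))"
    using integrable_inverse_1_plus_square by (simp add: set_integrable_def)
qed

text \<open>Take for \<open>b\<close> the direction of the largest coordinate. This turns bounds for powers of single
  coordinates into a bound by the integrable product of \<open>inverse (1 + (x \<bullet> b)\<^sup>2)\<close>.\<close>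

lemma prod_one_plus_square_le:
  fixes x :: "'a::euclidean_space"
  shows "\<exists>b\<in>Basis. (\<Prod>b\<in>Basis. 1 + (x \<bullet> b)\<^sup>2) \<le> 2 ^ DIM('a) * (1 + \<bar>x \<bullet> b\<bar> ^ (2 * DIM('a)))"
proof -
  let ?Q = "(\<lambda>b. (x \<bullet> b)\<^sup>2) ` (Basis :: 'a set)"
  have "Max ?Q \<in> ?Q" by (rule Max_in) auto
  then obtain b where b: "b \<in> Basis" and max: "Max ?Q = (x \<bullet> b)\<^sup>2" by (rule imageE) simp
  let ?s = "(x \<bullet> b)\<^sup>2"
  have "(\<Prod>c\<in>Basis. 1 + (x \<bullet> c)\<^sup>2) \<le> (\<Prod>c\<in>(Basis :: 'a set). 1 + ?s)"
    unfolding max[symmetric] by (intro prod_mono) (auto intro: add_nonneg_nonneg)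
  also have "\<dots> = (1 + ?s) ^ DIM('a)" by simp
  also have "\<dots> \<le> (2 * max 1 ?s) ^ DIM('a)" by (intro power_mono) auto
  also have "\<dots> = 2 ^ DIM('a) * (max 1 ?s) ^ DIM('a)" by (rule power_mult_distrib)
  also have "\<dots> \<le> 2 ^ DIM('a) * (1 + ?s ^ DIM('a))" by (auto simp: max_def)
  also have "?s ^ DIM('a) = \<bar>x \<bullet> b\<bar> ^ (2 * DIM('a))" by (simp add: power_mult)
  finally show ?thesis using b by blast
qed

lemma wave_integral_integrable:
  fixes u :: "real ^ 'd \<Rightarrow> real"
  assumes "test_function u"
  shows "integrable lborel (wave_integral (\<lambda>\<xi>. complex_of_real (u \<xi>)))"
proof -
  let ?W = "wave_integral (\<lambda>\<xi>. complex_of_real (u \<xi>))"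
  let ?d = "DIM(real ^ 'd)"
  let ?P = "\<lambda>x::real ^ 'd. \<Prod>b\<in>Basis. inverse (1 + (x \<bullet> b)\<^sup>2)"
  have "\<forall>b. \<exists>C. \<forall>x. \<bar>x \<bullet> b\<bar> ^ (2 * ?d) * norm (?W x) \<le> C"
    by (intro allI wave_integral_decay assms)
  from choice[OF this] obtain C where C: "\<And>b x. \<bar>x \<bullet> b\<bar> ^ (2 * ?d) * norm (?W x) \<le> C b"
    by (elim exE) (rule that, blast)
  define C0 where "C0 = (LINT \<xi>|lborel. norm (complex_of_real (u \<xi>)))"
  have C0: "norm (?W x) \<le> C0" for x
    unfolding C0_def by (rule wave_integral_norm_le)
  let ?K = "2 ^ ?d * (C0 + (\<Sum>b\<in>Basis. \<bar>C b\<bar>))"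
  have le: "norm (?W x) \<le> ?K * ?P x" for x
  proof -
    obtain b where b: "b \<in> Basis"
      and le: "(\<Prod>b\<in>Basis. 1 + (x \<bullet> b)\<^sup>2) \<le> 2 ^ ?d * (1 + \<bar>x \<bullet> b\<bar> ^ (2 * ?d))"
      using prod_one_plus_square_le[of x] by blast
    have pos: "0 < (\<Prod>b\<in>Basis. 1 + (x \<bullet> b)\<^sup>2)"
      by (intro prod_pos) (simp add: add_pos_nonneg)
    have "(\<Prod>b\<in>Basis. 1 + (x \<bullet> b)\<^sup>2) * norm (?W x) \<le> 2 ^ ?d * (1 + \<bar>x \<bullet> b\<bar> ^ (2 * ?d)) * norm (?W x)"
      using le by (rule mult_right_mono) simp
    also have "\<dots> = 2 ^ ?d * (norm (?W x) + \<bar>x \<bullet> b\<bar> ^ (2 * ?d) * norm (?W x))"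
      by (simp only: distrib_left distrib_right mult.assoc mult_1_left)
    also have "\<dots> \<le> 2 ^ ?d * (C0 + C b)"
      using C0 C by (intro mult_left_mono add_mono) auto
    also have "C b \<le> (\<Sum>b\<in>Basis. \<bar>C b\<bar>)"
      using member_le_sum[OF b, of "\<lambda>b. \<bar>C b\<bar>"] by simp
    finally have "(\<Prod>b\<in>Basis. 1 + (x \<bullet> b)\<^sup>2) * norm (?W x) \<le> ?K" by simp
    then have "norm (?W x) \<le> ?K / (\<Prod>b\<in>Basis. 1 + (x \<bullet> b)\<^sup>2)"
      by (simp only: pos_le_divide_eq[OF pos] mult.commute)
    moreover have "?P x = inverse (\<Prod>b\<in>Basis. 1 + (x \<bullet> b)\<^sup>2)"
      using prod_inversef[of "\<lambda>b. 1 + (x \<bullet> b)\<^sup>2" Basis] by (simp add: o_def)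
    ultimately show ?thesis by (simp only: divide_inverse)
  qed
  have W: "?W \<in> borel_measurable lborel"
    using wave_integral_continuous[OF test_function_cutoff_complex[OF assms]]
    by (simp add: borel_measurable_continuous_onI)
  have P: "integrable lborel (\<lambda>x. ?K * ?P x)"
    by (intro integrable_mult_right integrable_prod_cauchy)
  show ?thesis
    using P W by (rule Bochner_Integration.integrable_bound) (use le in \<open>auto intro: order_trans[OF _ abs_ge_self]\<close>)
qed

section \<open>Essential suprema of continuous functions\<close>

lemma Linf_norm_le:
  fixes F :: "real ^ 'd \<Rightarrow> complex"
  assumes "continuous_on UNIV F" and "\<And>x. norm (F x) \<le> B"
  shows "Linf_norm F \<le> ennreal B"
  unfolding Linf_norm_def
proof (rule esssup_I)
  have "F \<in> borel_measurable lebesgue"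
    using borel_measurable_continuous_onI[OF assms(1)] by (intro measurable_completion) simp
  then show "(\<lambda>x. ennreal (norm (F x))) \<in> borel_measurable lebesgue" by measurable
  show "AE x in lebesgue. ennreal (norm (F x)) \<le> ennreal B"
    using assms(2) by (intro AE_I2 ennreal_leI)
qed

text \<open>The set where the bound by the essential supremum holds is closed and has full measure, hence is the whole space.\<close>

lemma Linf_norm_ge:
  fixes F :: "real ^ 'd \<Rightarrow> complex"
  assumes F: "continuous_on UNIV F"
  shows "ennreal (norm (F x)) \<le> Linf_norm F"
proof -
  have "closed {y. ennreal (norm (F y)) \<le> Linf_norm F}"
    using F by (intro closed_Collect_le continuous_on_ennreal continuous_on_norm continuous_on_const)
  moreover have "AE y in lebesgue. y \<in> {y. ennreal (norm (F y)) \<le> Linf_norm F}"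
    unfolding Linf_norm_def mem_Collect_eq by (rule esssup_AE)
  ultimately have "x \<in> {y. ennreal (norm (F y)) \<le> Linf_norm F}"
    by (rule mem_closed_if_AE_lebesgue)
  then show ?thesis by simp
qed

section \<open>Lacunary sums\<close>

text \<open>The summands are dominated by the increments of the bounded function \<open>6 * a / (1 + a)\<close> between
  \<open>a\<close> and \<open>2 * a\<close>, and the increments telescope.\<close>

lemma dyadic_sum_le:
  fixes r :: real
  assumes "r \<ge> 0"
  shows "(\<Sum>k = 1..n. min (2 ^ k * r) (1 / (2 ^ k * r))) \<le> 6"
proof -
  define \<psi> where "\<psi> a = 6 * a / (1 + a)" for a :: real
  have step: "min a (1 / a) \<le> \<psi> (2 * a) - \<psi> a" if "a \<ge> 0" for a
  proof (cases "a = 0")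
    case False
    then have a: "a > 0" using that by simp
    have "\<psi> (2 * a) - \<psi> a = 6 * a / ((1 + 2 * a) * (1 + a))"
      using a unfolding \<psi>_def by (simp add: divide_simps) (simp add: algebra_simps)
    moreover have "min a (1 / a) \<le> 6 * a / ((1 + 2 * a) * (1 + a))"
    proof (cases "a \<le> 1")
      case True
      have "(1 + 2 * a) * (1 + a) \<le> 3 * 2"
        using a True by (intro mult_mono) auto
      then have "a * ((1 + 2 * a) * (1 + a)) \<le> 6 * a"
        using a by simp
      then have "a \<le> 6 * a / ((1 + 2 * a) * (1 + a))"
        using a by (simp add: pos_le_divide_eq)
      then show ?thesis by simp
    next
      case False
      have "(1 + 2 * a) * (1 + a) \<le> (3 * a) * (2 * a)"
        using a False by (intro mult_mono) auto
      then have "1 / a \<le> 6 * a / ((1 + 2 * a) * (1 + a))"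
        using a by (simp add: pos_le_divide_eq pos_divide_le_eq)
      then show ?thesis by simp
    qed
    ultimately show ?thesis by simp
  qed (simp add: \<psi>_def)
  have "(\<Sum>k = 1..n. min (2 ^ k * r) (1 / (2 ^ k * r))) \<le> \<psi> (2 * (2 ^ n * r))"
  proof (induction n)
    case 0
    then show ?case using assms by (simp add: \<psi>_def)
  next
    case (Suc n)
    have "min (2 ^ Suc n * r) (1 / (2 ^ Suc n * r)) \<le> \<psi> (2 * (2 ^ Suc n * r)) - \<psi> (2 ^ Suc n * r)"
      using assms by (intro step) simp
    then show ?case using Suc by (simp add: mult.assoc)
  qed
  also have "\<dots> \<le> 6"
  proof -
    have "\<psi> a \<le> 6" if "a \<ge> 0" for a
      using that unfolding \<psi>_def by (subst pos_divide_le_eq) auto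
    then show ?thesis using assms by simp
  qed
  finally show ?thesis .
qed

text \<open>The weights \<open>1 / k\<close> are simply bounded by 1: the gain comes from the decay of \<open>chi\<close> on both sides of
  the scale \<open>norm x = 1\<close>.\<close>

lemma f_seq_le_Gam:
  assumes small: "\<And>x. norm (chi x) \<le> M * norm x" and large: "\<And>x. norm x * norm (chi x) \<le> M"
    and "0 \<le> Gam n"
  shows "norm (f_seq chi n x) \<le> 6 * M * Gam n"
proof -
  have M: "M \<ge> 0" using large[of 0] by simp
  have term_le: "norm (complex_of_real (1 / real k) * chi (2 ^ k *\<^sub>R x))
      \<le> M * min (2 ^ k * norm x) (1 / (2 ^ k * norm x))" if "k \<in> {1..n}" for k
  proof -
    let ?y = "2 ^ k *\<^sub>R x"
    have "norm (chi ?y) \<le> M * min (norm ?y) (1 / norm ?y)"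
    proof (cases "x = 0")
      case True
      then show ?thesis using small[of 0] by simp
    next
      case False
      then have "norm ?y > 0" by simp
      then have "norm (chi ?y) \<le> M * (1 / norm ?y)"
        using large[of ?y] by (simp only: mult_1_right times_divide_eq_right pos_le_divide_eq mult.commute)
      moreover have "p \<le> M * min a b" if "p \<le> M * a" "p \<le> M * b" for p a b
        using that by (simp add: min_def)
      ultimately show ?thesis using small[of ?y] by blast
    qed
    moreover have "norm (complex_of_real (1 / real k) * chi ?y) \<le> norm (chi ?y)"
    proof -
      have "norm (complex_of_real (1 / real k)) \<le> 1"
        using that by (simp only: norm_of_real) simp
      then show ?thesis by (simp only: norm_mult mult_left_le_one_le norm_ge_zero)
    qed
    ultimately show ?thesis by simp
  qed
  have "norm (\<Sum>k = 1..n. complex_of_real (1 / real k) * chi (2 ^ k *\<^sub>R x))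
      \<le> (\<Sum>k = 1..n. M * min (2 ^ k * norm x) (1 / (2 ^ k * norm x)))"
    using term_le by (intro sum_norm_le)
  also have "\<dots> = M * (\<Sum>k = 1..n. min (2 ^ k * norm x) (1 / (2 ^ k * norm x)))"
    by (rule sum_distrib_left[symmetric])
  also have "\<dots> \<le> M * 6"
    using M by (intro mult_left_mono dyadic_sum_le) auto
  finally have "Gam n * norm (\<Sum>k = 1..n. complex_of_real (1 / real k) * chi (2 ^ k *\<^sub>R x)) \<le> Gam n * (M * 6)"
    using \<open>0 \<le> Gam n\<close> by (rule mult_left_mono)
  then show ?thesis
    unfolding f_seq_def norm_mult[of "complex_of_real (Gam n)"] norm_of_real abs_of_nonneg[OF \<open>0 \<le> Gam n\<close>]
    by (simp only: mult_ac)
qed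

lemma f_seq_continuous:
  assumes "continuous_on UNIV chi"
  shows "continuous_on UNIV (f_seq chi n)"
proof -
  have "continuous_on UNIV (\<lambda>x. chi (2 ^ k *\<^sub>R x))" for k
    by (rule continuous_on_compose2[OF assms]) (auto intro!: continuous_intros)
  then show ?thesis unfolding f_seq_def by (intro continuous_intros)
qed

lemma ln_gt_1: "n \<ge> 3 \<Longrightarrow> ln (real n) > 1"
proof -
  assume "n \<ge> 3"
  then have "exp 1 < real n" using e_less_272 by linarith
  then show ?thesis by (metis exp_gt_zero ln_exp ln_less_cancel_iff order_less_trans)
qed

lemma Gam_pos: "n \<ge> 3 \<Longrightarrow> Gam n > 0"
  using ln_gt_1[of n] by (simp add: Gam_def)

lemma harm_le_one_plus_ln:
  assumes "n > 0"
  shows "harm n \<le> 1 + ln (real n)"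
  using assms
proof (induction n rule: nat_induct_non_zero)
  case 1
  then show ?case by (simp add: harm_expand)
next
  case (Suc n)
  have "ln (real n / real (Suc n)) \<le> real n / real (Suc n) - 1"
    using Suc by (intro ln_le_minus_one) simp
  then have "ln (real n) - ln (real (Suc n)) \<le> real n / real (Suc n) - 1"
    using Suc.hyps by (subst (asm) ln_div) auto
  also have "real n / real (Suc n) - 1 = - inverse (real (Suc n))"
    by (simp add: field_simps)
  finally show ?case using Suc by (simp add: harm_Suc)
qed

lemma sum_inverse_eq_harm: "(\<Sum>k = 1..n. 1 / real k) = harm n"
  by (simp add: harm_def inverse_eq_divide)

lemma f_seq_le_harm:
  assumes "\<And>x. norm (V x) \<le> B" and "0 \<le> Gam n"
  shows "norm (f_seq V n x) \<le> Gam n * (harm n * B)"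
proof -
  have "norm (\<Sum>k = 1..n. complex_of_real (1 / real k) * V (2 ^ k *\<^sub>R x)) \<le> (\<Sum>k = 1..n. 1 / real k * B)"
  proof (rule sum_norm_le)
    fix k
    show "norm (complex_of_real (1 / real k) * V (2 ^ k *\<^sub>R x)) \<le> 1 / real k * B"
      using mult_left_mono[OF assms(1)[of "2 ^ k *\<^sub>R x"], of "1 / real k"]
      by (simp only: norm_mult norm_of_real) simp
  qed
  also have "\<dots> = harm n * B" by (simp only: sum_distrib_right[symmetric] sum_inverse_eq_harm)
  finally show ?thesis
    using assms(2) unfolding f_seq_def norm_mult norm_of_real by (simp add: mult_left_mono)
qed

lemma f_seq_0: "f_seq V n 0 = complex_of_real (Gam n * harm n) * V 0"
  unfolding f_seq_def sum_inverse_eq_harm[symmetric]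
  by (simp add: sum_distrib_right)

text \<open>Without cancellation at the origin, the full harmonic sum survives at \<open>x = 0\<close>, the fixed point of
  all dilations, where every term is a positive multiple of \<open>V 0\<close>.\<close>

lemma f_seq_log_growth:
  assumes V: "continuous_on UNIV V" and B: "\<And>x. norm (V x) \<le> B" and "V 0 \<noteq> 0"
  shows "\<exists>C>0. \<forall>n\<ge>3. ennreal (inverse C * (Gam n * ln (real n))) \<le> Linf_norm (f_seq V n) \<and>
     Linf_norm (f_seq V n) \<le> ennreal (C * (Gam n * ln (real n)))"
proof (intro exI conjI allI impI)
  \<comment> \<open>the factor 2 absorbs the constant in \<open>harm n \<le> 1 + ln n\<close>, as \<open>ln n > 1\<close> for \<open>n \<ge> 3\<close>\<close>
  let ?C = "max (2 * B) (inverse (norm (V 0)))"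
  have V0: "norm (V 0) > 0" using assms by simp
  then show C: "?C > 0" by (simp add: less_max_iff_disj)
  fix n :: nat assume n: "3 \<le> n"
  have G: "Gam n > 0" and ln: "ln (real n) > 1" using n Gam_pos ln_gt_1 by auto
  have "inverse ?C \<le> inverse (inverse (norm (V 0)))"
    using V0 by (intro le_imp_inverse_le) auto
  moreover have "ln (real n) \<le> harm n"
  proof -
    have "ln (real n) \<le> ln (real n + 1)" using n by (subst ln_le_cancel_iff) auto
    then show ?thesis using ln_le_harm[of n] by simp
  qed
  ultimately have "inverse ?C * (Gam n * ln (real n)) \<le> norm (V 0) * (Gam n * harm n)"
    using V0 G ln by (intro mult_mono) auto
  also have "\<dots> = norm (f_seq V n 0)"
    using G harm_nonneg[of n, where 'a = real] by (simp add: f_seq_0 norm_mult)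
  finally show "ennreal (inverse ?C * (Gam n * ln (real n))) \<le> Linf_norm (f_seq V n)"
    using Linf_norm_ge[OF f_seq_continuous[OF V], of n 0] by (meson ennreal_leI order_trans)
  show "Linf_norm (f_seq V n) \<le> ennreal (?C * (Gam n * ln (real n)))"
  proof (rule Linf_norm_le[OF f_seq_continuous[OF V]])
    fix x
    have "B \<ge> 0" using B[of 0] norm_ge_zero[of "V 0"] by linarith
    have "norm (f_seq V n x) \<le> Gam n * (harm n * B)"
      using G by (intro f_seq_le_harm B) simp
    also have "\<dots> \<le> Gam n * ((2 * ln (real n)) * B)"
      using G ln harm_le_one_plus_ln[of n] n \<open>B \<ge> 0\<close> by (intro mult_left_mono mult_right_mono) auto
    also have "\<dots> = (2 * B) * (Gam n * ln (real n))" by simp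
    also have "\<dots> \<le> ?C * (Gam n * ln (real n))"
      using G ln by (intro mult_right_mono) auto
    finally show "norm (f_seq V n x) \<le> ?C * (Gam n * ln (real n))" .
  qed
qed

section \<open>The Riesz transform of a lacunary sum\<close>

lemma riesz_symbol_cutoff:
  fixes u :: "real ^ 'd \<Rightarrow> real"
  assumes "cutoff u"
  shows "cutoff (\<lambda>\<xi>. \<xi> $ i / norm \<xi> * u \<xi>)"
proof (rule cutoff_mult_locally_bounded[OF assms])
  have [measurable]: "(\<lambda>\<xi>::real ^ 'd. \<xi> $ i) \<in> borel_measurable borel"
    by (intro borel_measurable_continuous_onI continuous_intros)
  have "(\<lambda>\<xi>::real ^ 'd. \<xi> $ i / norm \<xi>) \<in> borel_measurable borel" by measurable
  then show "(\<lambda>\<xi>. \<xi> $ i / norm \<xi> * u \<xi>) \<in> borel_measurable borel"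
    using assms by measurable
  have "norm (\<xi> $ i / norm \<xi>) \<le> 1" for \<xi> :: "real ^ 'd"
    using component_le_norm_cart[of \<xi> i] by (simp add: divide_le_eq_1)
  then show "\<exists>B. \<forall>\<xi>::real ^ 'd. norm \<xi> \<le> R \<longrightarrow> norm (\<xi> $ i / norm \<xi>) \<le> B" for R by blast
qed

lemma wave_integral_cmult: "wave_integral (\<lambda>\<xi>. a * u \<xi>) x = a * wave_integral u x"
  unfolding wave_integral_def by (simp only: mult.left_commute[of "cis _" a] integral_mult_right_zero)

lemma wave_integral_sum:
  assumes "\<And>k. k \<in> A \<Longrightarrow> integrable lborel (u k)"
  shows "wave_integral (\<lambda>\<xi>. \<Sum>k\<in>A. u k \<xi>) x = (\<Sum>k\<in>A. wave_integral (u k) x)"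
  unfolding wave_integral_def sum_distrib_left
  by (intro Bochner_Integration.integral_sum wave_integrand_integrable assms)

lemma wave_integral_f_seq:
  fixes chi :: "real ^ 'd \<Rightarrow> complex"
  assumes "integrable lborel chi"
  shows "wave_integral (f_seq chi n) x = complex_of_real (Gam n) * (\<Sum>k = 1..n. complex_of_real (1 / real k) *
     (complex_of_real ((1 / 2 ^ k) ^ CARD('d)) * wave_integral chi ((1 / 2 ^ k) *\<^sub>R x)))"
proof -
  have "integrable lborel (\<lambda>x. chi (2 ^ k *\<^sub>R x))" for k
    using lborel_integrable_affine[OF assms, of "2 ^ k" 0] by simp
  then have "wave_integral (f_seq chi n) x
      = complex_of_real (Gam n) * (\<Sum>k = 1..n. complex_of_real (1 / real k) * wave_integral (\<lambda>x. chi (2 ^ k *\<^sub>R x)) x)"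
    unfolding f_seq_def wave_integral_cmult
    by (subst wave_integral_sum) (auto simp only: wave_integral_cmult intro: integrable_mult_right)
  moreover have "wave_integral (\<lambda>x. chi (2 ^ k *\<^sub>R x)) x
      = complex_of_real ((1 / 2 ^ k) ^ CARD('d)) * wave_integral chi ((1 / 2 ^ k) *\<^sub>R x)" for k
    using assms by (subst wave_integral_scaled) auto
  ultimately show ?thesis by (simp only:)
qed

text \<open>The frequency content of the \<open>k\<close>-th term is that of \<open>chi\<close> dilated by \<open>2 ^ k\<close>, and the symbol takes the
  same value at \<open>\<xi>\<close> and \<open>\<xi> / 2 ^ k\<close>. The factors \<open>- \<i>\<close> of the symbol and \<open>\<i>\<close> of \<open>chi\<close> cancel.\<close>

lemma riesz_f_seq:
  fixes u :: "real ^ 'd \<Rightarrow> real" and i :: 'd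
  assumes u: "test_function u"
    and chi: "chi = (\<lambda>x. \<i> * complex_of_real (fourier_const TYPE('d)) * wave_integral (\<lambda>\<xi>. complex_of_real (u \<xi>)) x)"
  defines "v \<equiv> (\<lambda>\<xi>. complex_of_real (\<xi> $ i / norm \<xi> * u \<xi>))"
  shows "riesz i (f_seq chi n) = f_seq (\<lambda>x. complex_of_real (fourier_const TYPE('d)) * wave_integral v x) n"
proof
  fix x :: "real ^ 'd"
  let ?c = "complex_of_real (fourier_const TYPE('d))"
  let ?W = "wave_integral (\<lambda>\<xi>. complex_of_real (u \<xi>))"
  let ?s = "\<lambda>k. 1 / 2 ^ k :: real"
  have W: "integrable lborel ?W" using u by (rule wave_integral_integrable)
  then have ichi: "integrable lborel chi" unfolding chi by (rule integrable_mult_right)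
  have [measurable]: "chi \<in> borel_measurable borel" using ichi by auto
  have fm: "f_seq chi n \<in> borel_measurable borel" unfolding f_seq_def by measurable
  have "cutoff u" using u by (rule test_function_cutoff)
  then have cv: "cutoff v" unfolding v_def by (intro cutoff_of_real riesz_symbol_cutoff)
  then have [measurable]: "v \<in> borel_measurable borel" by measurable
  have iv: "integrable lborel (\<lambda>\<xi>. v (?s k *\<^sub>R \<xi>))" for k
    using lborel_integrable_affine[OF cutoff_integrable[OF cv], of "?s k" 0] by simp
  have inv: "wave_integral ?W (- \<xi>) = complex_of_real ((2 * pi) ^ CARD('d)) * complex_of_real (u \<xi>)" for \<xi>
    using wave_integral_inversion[OF test_function_cutoff_complex[OF u] _ W]
      test_function_continuous[OF u] by (simp add: continuous_on_of_real)
  have cc: "?c * (?c * complex_of_real ((2 * pi) ^ CARD('d))) = 1"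
    using fourier_const_square[where 'd = 'd]
    by (simp only: of_real_mult[symmetric] mult.assoc[symmetric] power2_eq_square) simp
  have fchi: "?c * wave_integral chi (?s k *\<^sub>R - \<xi>) = \<i> * complex_of_real (u (?s k *\<^sub>R \<xi>))" for k \<xi>
  proof -
    have "?c * wave_integral chi (?s k *\<^sub>R - \<xi>)
        = \<i> * (?c * (?c * complex_of_real ((2 * pi) ^ CARD('d)))) * complex_of_real (u (?s k *\<^sub>R \<xi>))"
      unfolding chi wave_integral_cmult scaleR_minus_right inv by (simp only: mult_ac)
    then show ?thesis unfolding cc by simp
  qed
  have symb: "- \<i> * complex_of_real (\<xi> $ i / norm \<xi>) * (\<i> * complex_of_real (u (?s k *\<^sub>R \<xi>))) = v (?s k *\<^sub>R \<xi>)" for k \<xi>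
  proof -
    have "- \<i> * a * (\<i> * b) = a * b" for a b :: complex
      by (simp add: mult.assoc mult.left_commute[of a \<i>])
    then show ?thesis by (simp only:) (simp add: v_def)
  qed
  have transform: "- \<i> * complex_of_real (\<xi> $ i / norm \<xi>) * fourier (f_seq chi n) \<xi>
      = complex_of_real (Gam n) * (\<Sum>k = 1..n. complex_of_real (1 / real k) *
          (complex_of_real (?s k ^ CARD('d)) * v (?s k *\<^sub>R \<xi>)))" for \<xi>
  proof -
    have "fourier (f_seq chi n) \<xi> = complex_of_real (Gam n) * (\<Sum>k = 1..n. complex_of_real (1 / real k) *
          (complex_of_real (?s k ^ CARD('d)) * (\<i> * complex_of_real (u (?s k *\<^sub>R \<xi>)))))"
      unfolding fourier_eq_wave_integral[OF fm] wave_integral_f_seq[OF ichi] fchi[symmetric] sum_distrib_left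
      by (simp only: mult_ac)
    then show ?thesis
      by (simp only: symb[symmetric] sum_distrib_left mult_ac)
  qed
  have "riesz i (f_seq chi n) x = ?c * wave_integral (\<lambda>\<xi>. complex_of_real (Gam n) *
      (\<Sum>k = 1..n. complex_of_real (1 / real k) * (complex_of_real (?s k ^ CARD('d)) * v (?s k *\<^sub>R \<xi>)))) x"
    unfolding riesz_def fourier_multiplier_def transform
    by (rule inv_fourier_eq_wave_integral) measurable
  also have "\<dots> = ?c * (complex_of_real (Gam n) * (\<Sum>k = 1..n. complex_of_real (1 / real k) *
      (complex_of_real (?s k ^ CARD('d)) * wave_integral (\<lambda>\<xi>. v (?s k *\<^sub>R \<xi>)) x)))"
    unfolding wave_integral_cmult
    by (subst wave_integral_sum, intro integrable_mult_right iv) (simp only: wave_integral_cmult)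
  also have "\<dots> = ?c * (complex_of_real (Gam n) * (\<Sum>k = 1..n. complex_of_real (1 / real k) * wave_integral v (2 ^ k *\<^sub>R x)))"
  proof -
    have "complex_of_real (?s k ^ CARD('d)) * wave_integral (\<lambda>\<xi>. v (?s k *\<^sub>R \<xi>)) x = wave_integral v (2 ^ k *\<^sub>R x)" for k
      by (subst wave_integral_scaled) (auto simp: power_divide)
    then show ?thesis by (simp only:)
  qed
  also have "\<dots> = f_seq (\<lambda>x. ?c * wave_integral v x) n x"
    unfolding f_seq_def sum_distrib_left by (simp only: mult_ac)
  finally show "riesz i (f_seq chi n) x = f_seq (\<lambda>x. ?c * wave_integral v x) n x" .
qed

text \<open>The mechanism behind the theorem: \<open>chi\<close> vanishes at the origin, while its Riesz transform does not.\<close>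

proposition lacunary_sum_bounds:
  fixes u :: "real ^ 'd \<Rightarrow> real" and i :: 'd
  assumes u: "test_function u"
    and chi: "chi = (\<lambda>x. \<i> * complex_of_real (fourier_const TYPE('d)) * wave_integral (\<lambda>\<xi>. complex_of_real (u \<xi>)) x)"
    and zero: "wave_integral (\<lambda>\<xi>. complex_of_real (u \<xi>)) 0 = 0"
    and nonzero: "(LINT \<xi>|lborel. \<xi> $ i / norm \<xi> * u \<xi>) \<noteq> 0"
  shows "(\<exists>C>0. \<forall>n\<ge>3. Linf_norm (f_seq chi n) \<le> ennreal (C * Gam n)) \<and>
         (\<exists>C>0. \<forall>n\<ge>3.
            ennreal (inverse C * (Gam n * ln (real n))) \<le> Linf_norm (riesz i (f_seq chi n)) \<and>
            Linf_norm (riesz i (f_seq chi n)) \<le> ennreal (C * (Gam n * ln (real n))))"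
proof
  let ?c = "complex_of_real (fourier_const TYPE('d))"
  let ?W = "wave_integral (\<lambda>\<xi>. complex_of_real (u \<xi>))"
  have cpos: "fourier_const TYPE('d) > 0" by (rule fourier_const_pos)
  have cont: "continuous_on UNIV chi"
    unfolding chi by (intro continuous_intros wave_integral_continuous test_function_cutoff_complex u)
  show "\<exists>C>0. \<forall>n\<ge>3. Linf_norm (f_seq chi n) \<le> ennreal (C * Gam n)"
  proof -
    obtain L where "L > 0" and L: "\<And>x y. norm (?W x - ?W y) \<le> L * norm (x - y)"
      using wave_integral_lipschitz[OF test_function_cutoff_complex[OF u]] by blast
    have "\<forall>b. \<exists>C. \<forall>x. \<bar>x \<bullet> b\<bar> ^ 1 * norm (?W x) \<le> C"
      by (intro allI wave_integral_decay u)
    from choice[OF this] obtain K where K: "\<And>b x. \<bar>x \<bullet> b\<bar> * norm (?W x) \<le> K b"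
      by auto
    \<comment> \<open>Lipschitz bound near the origin, first-order decay in every coordinate far away\<close>
    let ?M = "fourier_const TYPE('d) * max L (\<Sum>b\<in>Basis. K b)"
    have nchi: "norm (chi x) = fourier_const TYPE('d) * norm (?W x)" for x
      using cpos by (simp add: chi norm_mult)
    have small: "norm (chi x) \<le> ?M * norm x" for x
    proof -
      have "norm (?W x) \<le> L * norm x" using L[of x 0] zero by simp
      also have "\<dots> \<le> max L (\<Sum>b\<in>Basis. K b) * norm x" by (intro mult_right_mono) auto
      finally show ?thesis using cpos by (simp add: nchi mult.assoc)
    qed
    have large: "norm x * norm (chi x) \<le> ?M" for x
    proof -
      have "norm x * norm (?W x) \<le> (\<Sum>b\<in>Basis. \<bar>x \<bullet> b\<bar>) * norm (?W x)"
        by (intro mult_right_mono norm_le_l1) simp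
      also have "\<dots> \<le> (\<Sum>b\<in>Basis. K b)"
        unfolding sum_distrib_right by (intro sum_mono K)
      finally have "norm x * norm (?W x) \<le> max L (\<Sum>b\<in>Basis. K b)" by simp
      then show ?thesis using cpos by (simp add: nchi mult.left_commute[of "norm x"])
    qed
    have "Linf_norm (f_seq chi n) \<le> ennreal (6 * ?M * Gam n)" if "n \<ge> 3" for n
      using f_seq_le_Gam[OF small large] Gam_pos[OF that]
      by (intro Linf_norm_le f_seq_continuous cont) auto
    moreover have "6 * ?M > 0" using cpos \<open>L > 0\<close> by (simp add: less_max_iff_disj)
    ultimately show ?thesis by blast
  qed
  let ?v = "\<lambda>\<xi>. complex_of_real (\<xi> $ i / norm \<xi> * u \<xi>)"
  let ?V = "\<lambda>x. ?c * wave_integral ?v x"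
  have "cutoff u" using u by (rule test_function_cutoff)
  then have "cutoff ?v" by (intro cutoff_of_real riesz_symbol_cutoff)
  then have "continuous_on UNIV ?V"
    by (intro continuous_intros wave_integral_continuous)
  moreover have "norm (?V x) \<le> fourier_const TYPE('d) * (LINT \<xi>|lborel. norm (?v \<xi>))" for x
    using cpos wave_integral_norm_le[of ?v x] by (simp only: norm_mult norm_of_real) (simp del: of_real_mult)
  moreover have "?V 0 \<noteq> 0"
  proof -
    have "wave_integral ?v 0 = complex_of_real (LINT \<xi>|lborel. \<xi> $ i / norm \<xi> * u \<xi>)"
      unfolding wave_integral_def by (simp del: of_real_mult of_real_divide)
    then show ?thesis using nonzero cpos by simp
  qed
  ultimately show "\<exists>C>0. \<forall>n\<ge>3.
            ennreal (inverse C * (Gam n * ln (real n))) \<le> Linf_norm (riesz i (f_seq chi n)) \<and>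
            Linf_norm (riesz i (f_seq chi n)) \<le> ennreal (C * (Gam n * ln (real n)))"
    unfolding riesz_f_seq[OF u chi] by (rule f_seq_log_growth)
qed

section \<open>The Riesz transform does not vanish at the origin\<close>

lemma partial_deriv_eqI:
  assumes "((\<lambda>t. F (x + t *\<^sub>R axis i 1)) has_vector_derivative D) (at 0)"
  shows "partial_deriv i F x = D"
  unfolding partial_deriv_def using assms by (rule vector_derivative_at)

lemma AE_continuous_eq_0:
  fixes g :: "real ^ 'd \<Rightarrow> real"
  assumes "continuous_on UNIV g" and "AE x in lborel. g x = 0"
  shows "g x = 0"
proof -
  have "closed {x. g x = 0}"
    using assms(1) by (intro closed_Collect_eq continuous_on_const)
  moreover have "AE x in lebesgue. x \<in> {x. g x = 0}"
    using AE_completion[OF assms(2)] by simp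
  ultimately have "x \<in> {x. g x = 0}" by (rule mem_closed_if_AE_lebesgue)
  then show ?thesis by simp
qed

text \<open>The comparison with \<open>g\<close> avoids asking for continuity of \<open>f\<close>, which has \<open>norm \<xi>\<close> in a denominator in the applications.\<close>

lemma integral_pos_if_continuous_comparison:
  fixes f g :: "real ^ 'd \<Rightarrow> real"
  assumes f: "integrable lborel f" and nonneg: "\<And>x. 0 \<le> f x"
    and zero: "\<And>x. f x = 0 \<Longrightarrow> g x = 0"
    and g: "continuous_on UNIV g" and "g x\<^sub>0 \<noteq> 0"
  shows "(LINT x|lborel. f x) \<noteq> 0"
proof
  assume "(LINT x|lborel. f x) = 0"
  then have "AE x in lborel. f x = 0"
    using integral_nonneg_eq_0_iff_AE[OF f] nonneg by simp
  then have "AE x in lborel. g x = 0"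
    by eventually_elim (rule zero)
  with g have "g x\<^sub>0 = 0" by (rule AE_continuous_eq_0)
  with \<open>g x\<^sub>0 \<noteq> 0\<close> show False ..
qed

lemma norm_axis: "norm (axis j c :: real ^ 'd) = \<bar>c\<bar>"
  by (simp add: norm_eq_sqrt_inner inner_axis_axis)

text \<open>Radiality makes it possible to choose a point of the support on a coordinate axis, where the weights
  \<open>(\<xi> $ i)\<^sup>2\<close> and \<open>(norm \<xi>)\<^sup>2 - (\<xi> $ i)\<^sup>2\<close> are easily seen to be positive.\<close>

lemma radial_nonzero_on_axis:
  assumes "radial \<phi>" and "\<phi> \<xi> \<noteq> 0"
  shows "\<phi> (axis j (norm \<xi>)) \<noteq> 0"
proof -
  have "norm (axis j (norm \<xi>)) = norm \<xi>" by (simp add: norm_axis)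
  then have "\<phi> (axis j (norm \<xi>)) = \<phi> \<xi>" using assms(1) unfolding radial_def by blast
  then show ?thesis using assms(2) by simp
qed

lemma integral_riesz_symbol_coordinate_mult_nonzero:
  fixes \<phi> :: "real ^ 'd \<Rightarrow> real"
  assumes \<phi>: "test_function \<phi>" and "radial \<phi>" and nonneg: "\<And>\<xi>. 0 \<le> \<phi> \<xi>"
    and \<xi>\<^sub>0: "\<phi> \<xi>\<^sub>0 \<noteq> 0" "\<xi>\<^sub>0 \<noteq> 0"
  shows "(LINT \<xi>|lborel. \<xi> $ i / norm \<xi> * (\<xi> $ i * \<phi> \<xi>)) \<noteq> 0"
proof (rule integral_pos_if_continuous_comparison[where g = "\<lambda>\<xi>. \<xi> $ i * (\<xi> $ i * \<phi> \<xi>)"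
      and x\<^sub>0 = "axis i (norm \<xi>\<^sub>0)"])
  have u: "test_function (\<lambda>\<xi>. \<xi> $ i * \<phi> \<xi>)" using \<phi> by (rule test_function_coordinate_mult)
  then have "cutoff (\<lambda>\<xi>. \<xi> $ i * \<phi> \<xi>)" by (rule test_function_cutoff)
  then show "integrable lborel (\<lambda>\<xi>. \<xi> $ i / norm \<xi> * (\<xi> $ i * \<phi> \<xi>))"
    by (intro cutoff_integrable riesz_symbol_cutoff)
  show "0 \<le> \<xi> $ i / norm \<xi> * (\<xi> $ i * \<phi> \<xi>)" for \<xi>
    using nonneg[of \<xi>] by (simp add: mult.assoc[symmetric])
  show "\<xi> $ i * (\<xi> $ i * \<phi> \<xi>) = 0" if "\<xi> $ i / norm \<xi> * (\<xi> $ i * \<phi> \<xi>) = 0" for \<xi>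
    using that by auto
  show "continuous_on UNIV (\<lambda>\<xi>. \<xi> $ i * (\<xi> $ i * \<phi> \<xi>))"
    by (intro continuous_intros test_function_continuous[OF \<phi>])
  show "axis i (norm \<xi>\<^sub>0) $ i * (axis i (norm \<xi>\<^sub>0) $ i * \<phi> (axis i (norm \<xi>\<^sub>0))) \<noteq> 0"
    using radial_nonzero_on_axis[OF \<open>radial \<phi>\<close> \<xi>\<^sub>0(1)] \<xi>\<^sub>0(2) by simp
qed

lemma has_derivative_riesz_symbol:
  fixes \<xi> :: "real ^ 'd"
  assumes "\<xi> \<noteq> 0"
  shows "((\<lambda>\<xi>. \<xi> $ i / norm \<xi>) has_derivative
    (\<lambda>h. (h $ i * norm \<xi> - \<xi> $ i * (sgn \<xi> \<bullet> h)) / (norm \<xi> * norm \<xi>))) (at \<xi>)"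
proof (rule has_derivative_divide')
  show "((\<lambda>x. x $ i) has_derivative (\<lambda>v. v $ i)) (at \<xi>)"
    by (rule bounded_linear_imp_has_derivative) (rule bounded_linear_vec_nth)
  show "(norm has_derivative (\<lambda>h. sgn \<xi> \<bullet> h)) (at \<xi>)"
    using has_derivative_norm[OF assms] by (simp add: inner_commute)
qed (use assms in simp)

lemma frechet_derivative_riesz_symbol_mult:
  fixes \<phi> :: "real ^ 'd \<Rightarrow> real" and i :: 'd
  assumes \<phi>: "\<And>\<xi>. \<phi> differentiable (at \<xi>)" and "r > 0" and r: "\<And>\<xi>. norm \<xi> < r \<Longrightarrow> \<phi> \<xi> = 0"
  defines "F \<equiv> \<lambda>\<xi>. \<xi> $ i / norm \<xi> * \<phi> \<xi>"
  shows "F differentiable (at \<xi>)"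
    and "frechet_derivative F (at \<xi>) (axis i 1) = \<xi> $ i / norm \<xi> * frechet_derivative \<phi> (at \<xi>) (axis i 1)
      + ((norm \<xi>)\<^sup>2 - (\<xi> $ i)\<^sup>2) / norm \<xi> ^ 3 * \<phi> \<xi>"
proof -
  let ?D = "\<lambda>h. \<xi> $ i / norm \<xi> * frechet_derivative \<phi> (at \<xi>) h
      + (h $ i * norm \<xi> - \<xi> $ i * (sgn \<xi> \<bullet> h)) / (norm \<xi> * norm \<xi>) * \<phi> \<xi>"
  have D: "(F has_derivative ?D) (at \<xi>)"
  proof (cases "\<xi> = 0")
    case False
    show ?thesis unfolding F_def
      using has_derivative_riesz_symbol[OF False] \<phi>[of \<xi>]
      by (intro has_derivative_mult) (simp_all add: frechet_derivative_works)
  next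
    case True
    have "(F has_derivative (\<lambda>_. 0)) (at \<xi>)"
    proof (rule has_derivative_transform_within_open[rotated])
      show "((\<lambda>_. 0) has_derivative (\<lambda>_. 0 :: real)) (at \<xi>)" by (rule has_derivative_const)
      show "open (ball (0 :: real ^ 'd) r)" by simp
    qed (use True \<open>r > 0\<close> r in \<open>auto simp: F_def\<close>)
    \<comment> \<open>all quotients by \<open>norm \<xi> = 0\<close> are 0\<close>
    moreover have "?D = (\<lambda>_. 0)" using True by simp
    ultimately show ?thesis by simp
  qed
  then show "F differentiable (at \<xi>)" by (rule differentiableI)
  have "((1 :: real) * norm \<xi> - \<xi> $ i * (\<xi> $ i / norm \<xi>)) / (norm \<xi> * norm \<xi>)
      = ((norm \<xi>)\<^sup>2 - (\<xi> $ i)\<^sup>2) / norm \<xi> ^ 3"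
    by (cases "\<xi> = 0") (simp_all add: field_simps power2_eq_square power3_eq_cube)
  moreover have "sgn \<xi> \<bullet> axis i 1 = \<xi> $ i / norm \<xi>"
    by (simp add: inner_axis sgn_div_norm divide_inverse)
  ultimately show "frechet_derivative F (at \<xi>) (axis i 1) = \<xi> $ i / norm \<xi> * frechet_derivative \<phi> (at \<xi>) (axis i 1)
      + ((norm \<xi>)\<^sup>2 - (\<xi> $ i)\<^sup>2) / norm \<xi> ^ 3 * \<phi> \<xi>"
    using fun_cong[OF frechet_derivative_at[OF D], of "axis i 1"] by simp
qed

lemma continuous_on_mult_vanishing_near_0:
  fixes m w :: "real ^ 'd \<Rightarrow> real"
  assumes w: "continuous_on UNIV w" and m: "continuous_on (- {0}) m"
    and "r > 0" and r: "\<And>\<xi>. norm \<xi> < r \<Longrightarrow> w \<xi> = 0"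
  shows "continuous_on UNIV (\<lambda>\<xi>. m \<xi> * w \<xi>)"
proof -
  have "continuous_on (ball 0 r \<union> - {0}) (\<lambda>\<xi>. m \<xi> * w \<xi>)"
  proof (rule continuous_on_open_Un)
    have "continuous_on (ball 0 r) (\<lambda>_::real ^ 'd. 0 :: real)" by (rule continuous_on_const)
    then show "continuous_on (ball 0 r) (\<lambda>\<xi>. m \<xi> * w \<xi>)"
      by (rule continuous_on_eq) (simp add: r)
    show "continuous_on (- {0}) (\<lambda>\<xi>. m \<xi> * w \<xi>)"
      using m continuous_on_subset[OF w] by (intro continuous_on_mult) auto
  qed auto
  moreover have "ball (0 :: real ^ 'd) r \<union> - {0} = UNIV" using \<open>r > 0\<close> by auto
  ultimately show ?thesis by simp
qed

text \<open>Integrate by parts: \<open>\<xi> $ i / norm \<xi> * \<phi> \<xi>\<close> is differentiable because \<open>\<phi>\<close> vanishes near the origin,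
  and the integral of its partial derivative is 0. What remains is minus the integral of \<open>\<phi>\<close> against
  \<open>((norm \<xi>)\<^sup>2 - (\<xi> $ i)\<^sup>2) / norm \<xi> ^ 3\<close>, which is nonnegative and positive on the axis of any
  coordinate other than \<open>i\<close>.\<close>

lemma integral_riesz_symbol_partial_derivative_nonzero:
  fixes \<phi> :: "real ^ 'd \<Rightarrow> real" and i :: 'd
  assumes \<phi>: "test_function \<phi>" and "radial \<phi>" and nonneg: "\<And>\<xi>. 0 \<le> \<phi> \<xi>"
    and \<xi>\<^sub>0: "\<phi> \<xi>\<^sub>0 \<noteq> 0" "\<xi>\<^sub>0 \<noteq> 0"
    and "r > 0" and r: "\<And>\<xi>. norm \<xi> < r \<Longrightarrow> \<phi> \<xi> = 0"
    and card: "CARD('d) \<ge> 2"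
  shows "(LINT \<xi>|lborel. \<xi> $ i / norm \<xi> * frechet_derivative \<phi> (at \<xi>) (axis i 1)) \<noteq> 0"
proof -
  let ?w = "\<lambda>\<xi>. frechet_derivative \<phi> (at \<xi>) (axis i 1)"
  let ?F = "\<lambda>\<xi>. \<xi> $ i / norm \<xi> * \<phi> \<xi>"
  let ?q = "\<lambda>\<xi>::real ^ 'd. ((norm \<xi>)\<^sup>2 - (\<xi> $ i)\<^sup>2) / norm \<xi> ^ 3"
  obtain R where R: "\<And>\<xi>. R < norm \<xi> \<Longrightarrow> \<phi> \<xi> = 0"
    using \<phi> by (auto simp: test_function_def)
  have "Ck (Suc 0) \<phi>" using \<phi> unfolding test_function_def smooth_def by blast
  then have diff: "\<And>\<xi>. \<phi> differentiable (at \<xi>)" by simp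
  have w: "test_function ?w" using \<phi> by (rule test_function_frechet_derivative)
  have w0: "?w \<xi> = 0" if "norm \<xi> < r" for \<xi>
  proof -
    have "(\<phi> has_derivative (\<lambda>_. 0)) (at \<xi>)"
    proof (rule has_derivative_transform_within_open[rotated])
      show "((\<lambda>_. 0) has_derivative (\<lambda>_. 0 :: real)) (at \<xi>)" by (rule has_derivative_const)
      show "open (ball (0 :: real ^ 'd) r)" by simp
    qed (use that r in auto)
    from fun_cong[OF frechet_derivative_at[OF this]] show ?thesis by (rule sym)
  qed
  have dF: "frechet_derivative ?F (at \<xi>) (axis i 1) = \<xi> $ i / norm \<xi> * ?w \<xi> + ?q \<xi> * \<phi> \<xi>" for \<xi>
    using diff \<open>r > 0\<close> r by (rule frechet_derivative_riesz_symbol_mult(2))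
  have cont1: "continuous_on UNIV (\<lambda>\<xi>. \<xi> $ i / norm \<xi> * ?w \<xi>)"
    using w0 \<open>r > 0\<close>
    by (intro continuous_on_mult_vanishing_near_0[where r = r] test_function_continuous[OF w])
       (auto intro!: continuous_intros)
  have cont2: "continuous_on UNIV (\<lambda>\<xi>. ?q \<xi> * \<phi> \<xi>)"
    using r \<open>r > 0\<close>
    by (intro continuous_on_mult_vanishing_near_0[where r = r] test_function_continuous[OF \<phi>])
       (auto intro!: continuous_intros)
  have int1: "integrable lborel (\<lambda>\<xi>. \<xi> $ i / norm \<xi> * ?w \<xi>)"
    by (intro cutoff_integrable riesz_symbol_cutoff test_function_cutoff w)
  have int2: "integrable lborel (\<lambda>\<xi>. ?q \<xi> * \<phi> \<xi>)"
    using R by (intro cutoff_integrable cutoffI_continuous[OF cont2, of R]) simp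
  have "wave_integral (\<lambda>\<xi>. complex_of_real (frechet_derivative ?F (at \<xi>) (axis i 1))) 0
      = - \<i> * complex_of_real (0 \<bullet> (axis i 1 :: real ^ 'd)) * wave_integral (\<lambda>\<xi>. complex_of_real (?F \<xi>)) 0"
  proof (rule wave_integral_frechet_derivative)
    show "?F differentiable (at \<xi>)" for \<xi>
      using diff \<open>r > 0\<close> r by (rule frechet_derivative_riesz_symbol_mult(1))
    show "continuous_on UNIV (\<lambda>\<xi>. frechet_derivative ?F (at \<xi>) (axis i 1))"
      unfolding dF using cont1 cont2 by (rule continuous_on_add)
    show "?F \<xi> = 0" if "R < norm \<xi>" for \<xi> using R[OF that] by simp
  qed
  then have "complex_of_real (LINT \<xi>|lborel. \<xi> $ i / norm \<xi> * ?w \<xi> + ?q \<xi> * \<phi> \<xi>) = 0"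
    unfolding dF wave_integral_def by (simp del: of_real_add of_real_mult of_real_divide)
  then have "(LINT \<xi>|lborel. \<xi> $ i / norm \<xi> * ?w \<xi>) = - (LINT \<xi>|lborel. ?q \<xi> * \<phi> \<xi>)"
    using Bochner_Integration.integral_add[OF int1 int2] by simp
  moreover have "(LINT \<xi>|lborel. ?q \<xi> * \<phi> \<xi>) \<noteq> 0"
  proof -
    have "\<exists>j. j \<noteq> i"
    proof (rule ccontr)
      assume "\<nexists>j. j \<noteq> i"
      then have "(UNIV :: 'd set) = {i}" by auto
      then have "CARD('d) = 1" by (metis is_singletonI is_singleton_altdef)
      with card show False by simp
    qed
    then obtain j where "j \<noteq> i" ..
    show ?thesis
    proof (rule integral_pos_if_continuous_comparison[OF int2, where
          g = "\<lambda>\<xi>. ((norm \<xi>)\<^sup>2 - (\<xi> $ i)\<^sup>2) * \<phi> \<xi>" and x\<^sub>0 = "axis j (norm \<xi>\<^sub>0)"])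
      have "(\<xi> $ i)\<^sup>2 \<le> (norm \<xi>)\<^sup>2" for \<xi> :: "real ^ 'd"
        using component_le_norm_cart[of \<xi> i] by (metis abs_ge_zero power2_abs power_mono)
      then show "0 \<le> ?q \<xi> * \<phi> \<xi>" for \<xi>
        using nonneg[of \<xi>] by (intro mult_nonneg_nonneg divide_nonneg_nonneg) auto
      show "((norm \<xi>)\<^sup>2 - (\<xi> $ i)\<^sup>2) * \<phi> \<xi> = 0" if "?q \<xi> * \<phi> \<xi> = 0" for \<xi>
        using that by auto
      show "continuous_on UNIV (\<lambda>\<xi>. ((norm \<xi>)\<^sup>2 - (\<xi> $ i)\<^sup>2) * \<phi> \<xi>)"
        by (intro continuous_intros test_function_continuous \<phi>)
      show "((norm (axis j (norm \<xi>\<^sub>0) :: real ^ 'd))\<^sup>2 - (axis j (norm \<xi>\<^sub>0) $ i)\<^sup>2) * \<phi> (axis j (norm \<xi>\<^sub>0)) \<noteq> 0"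
      proof -
        have "axis j (norm \<xi>\<^sub>0) $ i = 0" using \<open>j \<noteq> i\<close> by (simp add: axis_def)
        then show ?thesis
          using radial_nonzero_on_axis[OF \<open>radial \<phi>\<close> \<xi>\<^sub>0(1), of j] \<xi>\<^sub>0(2)
          by (simp only: norm_axis) simp
      qed
    qed
  qed
  ultimately show ?thesis by simp
qed

section \<open>Bounds for the lacunary sum and its Riesz transform\<close>

lemma wave_integral_odd_0:
  fixes u :: "real ^ 'd \<Rightarrow> complex"
  assumes [measurable]: "u \<in> borel_measurable borel" and odd: "\<And>\<xi>. u (- \<xi>) = - u \<xi>"
  shows "wave_integral u 0 = 0"
proof -
  have "(LINT \<xi>|lborel. u \<xi>) = (LINT \<xi>|lborel. - u \<xi>)"
    using lborel_integral_affine[of u "-1" 0] by (simp add: odd)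
  then show ?thesis by (simp add: wave_integral_def)
qed

theorem proposition1p2:
  fixes \<phi> :: "real ^ 'd \<Rightarrow> real" and chi :: "real ^ 'd \<Rightarrow> complex" and i :: 'd
  assumes "\<And>\<xi>. \<phi> \<xi> \<in> {0..1}"
    and "radial \<phi>"
    and "smooth \<phi>"
    and "\<exists>\<xi>. \<phi> \<xi> \<noteq> 0"
    and "closure {\<xi>. \<phi> \<xi> \<noteq> 0} \<subseteq> {\<xi>. 4 / 3 \<le> norm \<xi> \<and> norm \<xi> \<le> 3 / 2}"
    and "chi = partial_deriv i (inv_fourier (\<lambda>\<xi>. complex_of_real (\<phi> \<xi>))) \<or>
         CARD('d) \<ge> 2 \<and>
         chi = (\<lambda>x. complex_of_real (x $ i) * inv_fourier (\<lambda>\<xi>. complex_of_real (\<phi> \<xi>)) x)"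
  shows "(\<exists>C>0. \<forall>n\<ge>3. Linf_norm (f_seq chi n) \<le> ennreal (C * Gam n)) \<and>
         (\<exists>C>0. \<forall>n\<ge>3.
            ennreal (inverse C * (Gam n * ln (real n))) \<le> Linf_norm (riesz i (f_seq chi n)) \<and>
            Linf_norm (riesz i (f_seq chi n)) \<le> ennreal (C * (Gam n * ln (real n))))"
proof -
  have nonneg: "\<And>\<xi>. 0 \<le> \<phi> \<xi>" using assms(1) by simp
  have supp: "4 / 3 \<le> norm \<xi>" "norm \<xi> \<le> 3 / 2" if "\<phi> \<xi> \<noteq> 0" for \<xi>
    using that assms(5) closure_subset[of "{\<xi>. \<phi> \<xi> \<noteq> 0}"] by auto
  have inner: "\<phi> \<xi> = 0" if "norm \<xi> < 4 / 3" for \<xi> using supp(1)[of \<xi>] that by fastforce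
  have \<phi>: "test_function \<phi>"
    unfolding test_function_def using assms(3) supp(2) by (metis not_le)
  obtain \<xi>\<^sub>0 where \<xi>\<^sub>0: "\<phi> \<xi>\<^sub>0 \<noteq> 0" using assms(4) by blast
  then have \<xi>\<^sub>0_ne: "\<xi>\<^sub>0 \<noteq> 0" using supp(1)[of \<xi>\<^sub>0] by auto
  let ?c = "complex_of_real (fourier_const TYPE('d))"
  let ?W = "wave_integral (\<lambda>\<xi>. complex_of_real (\<phi> \<xi>))"
  have c\<phi>: "cutoff (\<lambda>\<xi>. complex_of_real (\<phi> \<xi>))" using \<phi> by (rule test_function_cutoff_complex)
  have inv: "inv_fourier (\<lambda>\<xi>. complex_of_real (\<phi> \<xi>)) x = ?c * ?W x" for x
    by (rule inv_fourier_eq_wave_integral[OF cutoff_measurable[OF c\<phi>]])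
  from assms(6) show ?thesis
  proof (elim disjE conjE)
    assume chi: "chi = partial_deriv i (inv_fourier (\<lambda>\<xi>. complex_of_real (\<phi> \<xi>)))"
    let ?u = "\<lambda>\<xi>. \<xi> $ i * \<phi> \<xi>"
    have u: "test_function ?u" using \<phi> by (rule test_function_coordinate_mult)
    have "chi x = \<i> * ?c * wave_integral (\<lambda>\<xi>. complex_of_real (?u \<xi>)) x" for x
    proof -
      have "((\<lambda>t. ?c * ?W (x + t *\<^sub>R axis i 1)) has_vector_derivative
          ?c * wave_integral (\<lambda>\<xi>. \<i> * (complex_of_real (\<xi> $ i) * complex_of_real (\<phi> \<xi>))) x) (at 0)"
        by (intro has_vector_derivative_mult_right wave_integral_has_partial_derivative c\<phi>)
      then have "chi x = ?c * wave_integral (\<lambda>\<xi>. \<i> * (complex_of_real (\<xi> $ i) * complex_of_real (\<phi> \<xi>))) x"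
        unfolding chi by (intro partial_deriv_eqI) (simp add: inv)
      then show ?thesis unfolding wave_integral_cmult by simp
    qed
    then have chi': "chi = (\<lambda>x. \<i> * ?c * wave_integral (\<lambda>\<xi>. complex_of_real (?u \<xi>)) x)" by (rule ext)
    have "\<phi> (- \<xi>) = \<phi> \<xi>" for \<xi> using assms(2) unfolding radial_def by (metis norm_minus_cancel)
    then have "wave_integral (\<lambda>\<xi>. complex_of_real (?u \<xi>)) 0 = 0"
      using test_function_cutoff_complex[OF u] by (intro wave_integral_odd_0) auto
    moreover have "(LINT \<xi>|lborel. \<xi> $ i / norm \<xi> * ?u \<xi>) \<noteq> 0"
      by (rule integral_riesz_symbol_coordinate_mult_nonzero[OF \<phi> assms(2) nonneg \<xi>\<^sub>0 \<xi>\<^sub>0_ne])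
    ultimately show ?thesis
      using u chi' by (intro lacunary_sum_bounds)
  next
    assume card: "CARD('d) \<ge> 2"
      and chi: "chi = (\<lambda>x. complex_of_real (x $ i) * inv_fourier (\<lambda>\<xi>. complex_of_real (\<phi> \<xi>)) x)"
    let ?u = "\<lambda>\<xi>. frechet_derivative \<phi> (at \<xi>) (axis i 1)"
    have u: "test_function ?u" using \<phi> by (rule test_function_frechet_derivative)
    have wu: "wave_integral (\<lambda>\<xi>. complex_of_real (?u \<xi>)) x = - \<i> * complex_of_real (x $ i) * ?W x" for x
      using wave_integral_test_function_derivative[OF \<phi>, of "axis i 1" x] by (simp add: inner_axis)
    have chi': "chi = (\<lambda>x. \<i> * ?c * wave_integral (\<lambda>\<xi>. complex_of_real (?u \<xi>)) x)"
      unfolding chi inv wu by (simp add: fun_eq_iff mult_ac)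
    have "wave_integral (\<lambda>\<xi>. complex_of_real (?u \<xi>)) 0 = 0" by (simp add: wu)
    moreover have "(LINT \<xi>|lborel. \<xi> $ i / norm \<xi> * ?u \<xi>) \<noteq> 0"
      by (rule integral_riesz_symbol_partial_derivative_nonzero[where r = "4 / 3", OF \<phi> assms(2) nonneg \<xi>\<^sub>0 \<xi>\<^sub>0_ne])
        (use inner card in auto)
    ultimately show ?thesis
      using u chi' by (intro lacunary_sum_bounds)
  qed
qed

end
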